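(* Suppose that for every positive integer $d$, every $d(d+1)$-connected graph is rigid in $\mathbb{R}^d$. Then every graph $G=(V,E)$ satisfies $\operatorname{grn}(G)\ge\left\lfloor\sqrt{\frac{|E|}{6|V|}}\right\rfloor$.
   Context: A framework $(G,p)$ in $\mathbb{R}^d$ is generic if the coordinates of all $p(v)$ are algebraically independent over $\mathbb{Q}$. It is rigid if there is $\varepsilon>0$ such that every $q$ with $\|q(u)-q(v)\|=\|p(u)-p(v)\|$ for all edges $uv$ and $\|p(v)-q(v)\|<\varepsilon$ for all $v$ satisfies this equality for all vertex pairs; it is globally rigid if this holds without the $\varepsilon$ restriction. A graph is rigid (resp. globally rigid) in $\mathbb{R}^d$ if its generic realizations in $\mathbb{R}^d$ are rigid (resp. globally rigid). A graph is $k$-connected if it has at least $k+1$ vertices and stays connected after deleting fewer than $k$ vertices. For a graph $G$, $\operatorname{grn}(G)$ is the largest $d$ such that $G$ has a subgraph on at least $d+2$ vertices that is globally rigid in $\mathbb{R}^d$, or $0$ if there is no such $d$. *)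

theory Defs
  imports "HOL-Analysis.L2_Norm" "HOL-Library.Poly_Mapping"
begin

definition simple_graph :: "'v set \<Rightarrow> 'v set set \<Rightarrow> bool" where
  "simple_graph V E \<longleftrightarrow> finite V \<and> (\<forall>e\<in>E. e \<subseteq> V \<and> card e = 2)"

definition subgraph :: "'v set \<Rightarrow> 'v set set \<Rightarrow> 'v set \<Rightarrow> 'v set set \<Rightarrow> bool" where
  "subgraph V' E' V E \<longleftrightarrow> simple_graph V' E' \<and> V' \<subseteq> V \<and> E' \<subseteq> E"

definition graph_connected :: "'v set \<Rightarrow> 'v set set \<Rightarrow> bool" where
  "graph_connected V E \<longleftrightarrow>
     V \<noteq> {} \<and> (\<forall>u\<in>V. \<forall>v\<in>V. (u, v) \<in> {(x, y). {x, y} \<in> E}\<^sup>*)"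

definition k_connected :: "nat \<Rightarrow> 'v set \<Rightarrow> 'v set set \<Rightarrow> bool" where
  "k_connected k V E \<longleftrightarrow> k + 1 \<le> card V \<and>
     (\<forall>S. S \<subseteq> V \<and> card S < k \<longrightarrow> graph_connected (V - S) {e \<in> E. e \<inter> S = {}})"

text \<open>
  Points of \<open>\<real>\<^sup>d\<close> are functions \<open>nat \<Rightarrow> real\<close> of which only the coordinates
  \<open>i < d\<close> are ever inspected, so that \<open>d\<close> can be quantified over.
\<close>

definition dist_d :: "nat \<Rightarrow> (nat \<Rightarrow> real) \<Rightarrow> (nat \<Rightarrow> real) \<Rightarrow> real" where
  "dist_d d x y = L2_set (\<lambda>i. x i - y i) {..<d}"

text \<open>
  A polynomial with rational coefficients in indeterminates indexed by \<open>'i\<close> is a finitely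
  supported map from monomials to coefficients, a monomial being a finitely supported map
  from indeterminates to exponents.
\<close>

definition eval_rat_mpoly :: "('i \<Rightarrow> real) \<Rightarrow> (('i \<Rightarrow>\<^sub>0 nat) \<Rightarrow>\<^sub>0 rat) \<Rightarrow> real" where
  "eval_rat_mpoly x P =
     (\<Sum>m\<in>Poly_Mapping.keys P. of_rat (Poly_Mapping.lookup P m) *
        (\<Prod>i\<in>Poly_Mapping.keys m. x i ^ Poly_Mapping.lookup m i))"

definition alg_indep_rat :: "'i set \<Rightarrow> ('i \<Rightarrow> real) \<Rightarrow> bool" where
  "alg_indep_rat I x \<longleftrightarrow>
     (\<forall>P :: ('i \<Rightarrow>\<^sub>0 nat) \<Rightarrow>\<^sub>0 rat.
        (\<forall>m\<in>Poly_Mapping.keys P. Poly_Mapping.keys m \<subseteq> I) \<and> eval_rat_mpoly x P = 0 \<longrightarrow> P = 0)"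

definition generic :: "nat \<Rightarrow> 'v set \<Rightarrow> ('v \<Rightarrow> nat \<Rightarrow> real) \<Rightarrow> bool" where
  "generic d V p \<longleftrightarrow> alg_indep_rat (V \<times> {..<d}) (\<lambda>(v, i). p v i)"

definition equivalent_frameworks ::
  "nat \<Rightarrow> 'v set set \<Rightarrow> ('v \<Rightarrow> nat \<Rightarrow> real) \<Rightarrow> ('v \<Rightarrow> nat \<Rightarrow> real) \<Rightarrow> bool" where
  "equivalent_frameworks d E p q \<longleftrightarrow>
     (\<forall>u v. {u, v} \<in> E \<longrightarrow> dist_d d (q u) (q v) = dist_d d (p u) (p v))"

definition congruent_frameworks ::
  "nat \<Rightarrow> 'v set \<Rightarrow> ('v \<Rightarrow> nat \<Rightarrow> real) \<Rightarrow> ('v \<Rightarrow> nat \<Rightarrow> real) \<Rightarrow> bool" where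
  "congruent_frameworks d V p q \<longleftrightarrow>
     (\<forall>u\<in>V. \<forall>v\<in>V. dist_d d (q u) (q v) = dist_d d (p u) (p v))"

definition rigid_framework ::
  "nat \<Rightarrow> 'v set \<Rightarrow> 'v set set \<Rightarrow> ('v \<Rightarrow> nat \<Rightarrow> real) \<Rightarrow> bool" where
  "rigid_framework d V E p \<longleftrightarrow>
     (\<exists>\<epsilon>>0. \<forall>q. equivalent_frameworks d E p q \<and> (\<forall>v\<in>V. dist_d d (p v) (q v) < \<epsilon>)
        \<longrightarrow> congruent_frameworks d V p q)"

definition globally_rigid_framework ::
  "nat \<Rightarrow> 'v set \<Rightarrow> 'v set set \<Rightarrow> ('v \<Rightarrow> nat \<Rightarrow> real) \<Rightarrow> bool" where
  "globally_rigid_framework d V E p \<longleftrightarrow>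
     (\<forall>q. equivalent_frameworks d E p q \<longrightarrow> congruent_frameworks d V p q)"

definition rigid_graph :: "nat \<Rightarrow> 'v set \<Rightarrow> 'v set set \<Rightarrow> bool" where
  "rigid_graph d V E \<longleftrightarrow> (\<forall>p. generic d V p \<longrightarrow> rigid_framework d V E p)"

definition globally_rigid_graph :: "nat \<Rightarrow> 'v set \<Rightarrow> 'v set set \<Rightarrow> bool" where
  "globally_rigid_graph d V E \<longleftrightarrow> (\<forall>p. generic d V p \<longrightarrow> globally_rigid_framework d V E p)"

definition grn_dims :: "'v set \<Rightarrow> 'v set set \<Rightarrow> nat set" where
  "grn_dims V E =
     {d. 1 \<le> d \<and> (\<exists>V' E'. subgraph V' E' V E \<and> d + 2 \<le> card V' \<and> globally_rigid_graph d V' E')}"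

definition grn :: "'v set \<Rightarrow> 'v set set \<Rightarrow> nat" where
  "grn V E = (if grn_dims V E = {} then 0 else Max (grn_dims V E))"

text \<open>The maximum above is taken over a finite set, so it is a genuine one.\<close>

lemma finite_grn_dims:
  assumes "finite V"
  shows "finite (grn_dims V E)"
proof (rule finite_subset)
  show "grn_dims V E \<subseteq> {..card V}"
  proof
    fix d assume "d \<in> grn_dims V E"
    then obtain V' where "V' \<subseteq> V" "d + 2 \<le> card V'"
      unfolding grn_dims_def subgraph_def by auto
    with card_mono[OF assms \<open>V' \<subseteq> V\<close>] show "d \<in> {..card V}" by simp
  qed
qed simp

end

theory Submission
  imports Defs "HOL-Analysis.Analysis"
begin

text \<open>
  Put \<open>d = \<lfloor>sqrt (|E| / (6|V|))\<rfloor>\<close>. As \<open>|E| \<ge> 2 (3d\<^sup>2) |V|\<close>, Mader's argument yields a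
  \<open>3d\<^sup>2\<close>-connected subgraph, and \<open>3d\<^sup>2 \<ge> d(d+1) + 1\<close>. Every \<open>(d(d+1) + 1)\<close>-connected graph is globally
  rigid: deleting a vertex \<open>v\<close> leaves a \<open>d(d+1)\<close>-connected, hence rigid graph, and completing the
  neighbourhood of \<open>v\<close> in it gives a smaller \<open>(d(d+1) + 1)\<close>-connected graph, globally rigid by induction.
  By an argument of Tanigawa it remains to see that in any framework \<open>q\<close> equivalent to a generic \<open>p\<close> the
  distances between neighbours of \<open>v\<close> are those of \<open>p\<close>.

  The algebra is done with derivations of \<open>\<real>\<close>, which can be prescribed arbitrarily on an
  algebraically independent family. Both they and actual deformations of frameworks come from ring
  homomorphisms of \<open>\<real>\<close> into germs of functions. A derivation that kills the coordinates of
  \<open>p\<close> on \<open>G - v\<close> kills, by rigidity, all distances of \<open>q\<close> on \<open>G - v\<close>; letting \<open>p v\<close> move freely then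
  exhibits an isometry carrying the neighbours of \<open>v\<close> in \<open>q\<close> to those in \<open>p\<close>.
\<close>

section \<open>Connectivity\<close>

text \<open>The obstacle is that \<open>q\<close> is arbitrary: its coordinates may satisfy unknown
  algebraic relations, and nothing generic can be said about it directly. What it shares with
  \<open>p\<close> are the edge lengths, and a derivation of the reals acts on these numbers no
  matter from which framework they are computed. This is how information passes from
  \<open>p\<close> to \<open>q\<close>. The numbers killed by a family of derivations play the part
  that the algebraic closure of the field generated by the coordinates of \<open>p\<close> off
  \<open>v\<close> would play. They may form a larger field, but only two properties matter: it is
  closed under field operations and square roots, and the coordinates of \<open>p v\<close> still
  behave like free variables over it. Rigidity is given by nearby frameworks and not by the rank of
  a matrix, so a derivation that moves a distance must be turned into a true motion. This is why
  germs occur and not just an algebraic extension theorem for derivations.\<close>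

definition nbrs :: "'v set set \<Rightarrow> 'v \<Rightarrow> 'v set" where
  "nbrs E v = {w. {v, w} \<in> E}"

lemma simple_graph_finite_edges:
  assumes "simple_graph V E"
  shows "finite E"
  by (rule finite_subset[of E "Pow V"]) (use assms in \<open>auto simp: simple_graph_def\<close>)

lemma simple_graph_edge:
  assumes "simple_graph V E" "{x, y} \<in> E"
  shows "x \<in> V" "y \<in> V" "x \<noteq> y"
proof -
  have "{x, y} \<subseteq> V" "card {x, y} = 2" using assms unfolding simple_graph_def by auto
  then show "x \<in> V" "y \<in> V" "x \<noteq> y" by (auto simp: card_insert_if split: if_splits)
qed

lemma simple_graph_edgeE:
  assumes "simple_graph V E" "e \<in> E"
  obtains x y where "e = {x, y}" "x \<in> V" "y \<in> V" "x \<noteq> y"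
proof -
  have "card e = 2" "e \<subseteq> V" using assms unfolding simple_graph_def by auto
  then obtain x y where "e = {x, y}" "x \<noteq> y" by (auto simp: card_2_iff)
  with \<open>e \<subseteq> V\<close> show ?thesis using that by auto
qed

lemma simple_graph_subset:
  assumes "simple_graph V E" "V' \<subseteq> V" "E' \<subseteq> E" "\<And>e. e \<in> E' \<Longrightarrow> e \<subseteq> V'"
  shows "simple_graph V' E'"
  using assms finite_subset[of V' V] unfolding simple_graph_def by blast

lemma nbrs_subset:
  assumes "simple_graph V E"
  shows "nbrs E v \<subseteq> V - {v}"
  unfolding nbrs_def using simple_graph_edge[OF assms, of v] by auto

lemma graph_connected_iff_cut:
  assumes "\<And>x y. {x, y} \<in> E \<Longrightarrow> y \<in> V"
  shows "graph_connected V E \<longleftrightarrow> V \<noteq> {} \<and>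
    (\<forall>A. A \<subseteq> V \<and> A \<noteq> {} \<and> A \<noteq> V \<longrightarrow> (\<exists>x\<in>A. \<exists>y\<in>V - A. {x, y} \<in> E))"
    (is "?L \<longleftrightarrow> _ \<and> ?R")
proof -
  let ?r = "{(x, y). {x, y} \<in> E}"
  have 1: "\<exists>x\<in>A. \<exists>y\<in>V - A. {x, y} \<in> E"
    if conn: "?L" and A: "A \<subseteq> V" "A \<noteq> {}" "A \<noteq> V" for A
  proof (rule ccontr)
    assume no: "\<not> ?thesis"
    obtain u v where uv: "u \<in> A" "v \<in> V - A" using A by blast
    have "(u, v) \<in> ?r\<^sup>*" using conn uv A unfolding graph_connected_def by blast
    then have "v \<in> A"
    proof (induction rule: rtrancl_induct)
      case base
      show ?case using uv by simp
    next
      case (step y z)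
      then have "{y, z} \<in> E" by simp
      with assms[OF this] step no show ?case by blast
    qed
    with uv show False by simp
  qed
  have 2: "?L" if "V \<noteq> {}" and cut: "?R"
    unfolding graph_connected_def
  proof (intro conjI ballI)
    fix u v assume "u \<in> V" "v \<in> V"
    define A where "A = {w\<in>V. (u, w) \<in> ?r\<^sup>*}"
    have "A = V"
    proof (rule ccontr)
      assume "A \<noteq> V"
      moreover have "A \<subseteq> V" "A \<noteq> {}" using \<open>u \<in> V\<close> unfolding A_def by auto
      ultimately obtain x y where xy: "x \<in> A" "y \<in> V - A" "{x, y} \<in> E" using cut by blast
      then have "(u, y) \<in> ?r\<^sup>*" unfolding A_def by (auto intro: rtrancl_into_rtrancl)
      with xy show False unfolding A_def by simp
    qed
    then show "(u, v) \<in> ?r\<^sup>*" using \<open>v \<in> V\<close> unfolding A_def by blast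
  qed (fact that)
  show ?thesis
    using 1 2 unfolding graph_connected_def[of V E] by blast
qed

text \<open>Separations \<open>(S, A, B)\<close> treat both sides alike and keep the edge set fixed,
  so later proofs only move a vertex between the three parts and never handle reachability.\<close>

lemma k_connected_iff_cut:
  assumes G: "simple_graph V E"
  shows "k_connected k V E \<longleftrightarrow> k + 1 \<le> card V \<and>
    (\<forall>S A B. S \<union> A \<union> B = V \<and> S \<inter> A = {} \<and> S \<inter> B = {} \<and> A \<inter> B = {} \<and> A \<noteq> {} \<and> B \<noteq> {} \<and> card S < k
       \<longrightarrow> (\<exists>x\<in>A. \<exists>y\<in>B. {x, y} \<in> E))" (is "?L \<longleftrightarrow> _ \<and> ?R")
proof -
  have fin: "finite V" using G unfolding simple_graph_def by simp
  have cut: "graph_connected (V - S) {e \<in> E. e \<inter> S = {}} \<longleftrightarrow> V - S \<noteq> {} \<and>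
    (\<forall>A. A \<subseteq> V - S \<and> A \<noteq> {} \<and> A \<noteq> V - S \<longrightarrow> (\<exists>x\<in>A. \<exists>y\<in>V - S - A. {x, y} \<in> {e \<in> E. e \<inter> S = {}}))"
    for S
    by (rule graph_connected_iff_cut) (use simple_graph_edge[OF G] in auto)
  show ?thesis
  proof (intro iffI conjI allI impI)
    fix S A B
    assume L: ?L and S: "S \<union> A \<union> B = V \<and> S \<inter> A = {} \<and> S \<inter> B = {} \<and> A \<inter> B = {} \<and> A \<noteq> {} \<and> B \<noteq> {} \<and> card S < k"
    have VS: "V - S = A \<union> B" using S by blast
    have "S \<subseteq> V" using S by blast
    then have "graph_connected (V - S) {e \<in> E. e \<inter> S = {}}"
      using L S unfolding k_connected_def by blast
    then have "\<forall>A. A \<subseteq> V - S \<and> A \<noteq> {} \<and> A \<noteq> V - S \<longrightarrow>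
        (\<exists>x\<in>A. \<exists>y\<in>V - S - A. {x, y} \<in> {e \<in> E. e \<inter> S = {}})"
      unfolding cut by (rule conjunct2)
    moreover have "A \<subseteq> V - S" "A \<noteq> {}" "A \<noteq> V - S" using S VS by auto
    ultimately have "\<exists>x\<in>A. \<exists>y\<in>V - S - A. {x, y} \<in> {e \<in> E. e \<inter> S = {}}" by blast
    moreover have "V - S - A = B" using S by blast
    ultimately show "\<exists>x\<in>A. \<exists>y\<in>B. {x, y} \<in> E" by blast
  next
    assume R: "k + 1 \<le> card V \<and> ?R"
    show ?L unfolding k_connected_def
    proof (intro conjI allI impI)
      fix S assume S: "S \<subseteq> V \<and> card S < k"
      have "V - S \<noteq> {}" 
      proof
        assume "V - S = {}"
        then have "V = S" using S by blast
        then show False using S R by simp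
      qed
      moreover have "\<exists>x\<in>A. \<exists>y\<in>V - S - A. {x, y} \<in> {e \<in> E. e \<inter> S = {}}"
        if A: "A \<subseteq> V - S" "A \<noteq> {}" "A \<noteq> V - S" for A
      proof -
        have "S \<union> A \<union> (V - S - A) = V" "S \<inter> A = {}" "V - S - A \<noteq> {}" "S \<inter> (V - S - A) = {}"
          using A S by auto
        then have "\<exists>x\<in>A. \<exists>y\<in>V - S - A. {x, y} \<in> E"
          using conjunct2[OF R, rule_format, of S A "V - S - A"] A S by simp
        then show ?thesis using A by blast
      qed
      ultimately show "graph_connected (V - S) {e \<in> E. e \<inter> S = {}}" unfolding cut by blast
    qed (use R in simp)
  qed (auto simp: k_connected_def)
qed

lemma k_connected_cutD:
  assumes "simple_graph V E" "k_connected k V E" "S \<union> A \<union> B = V" "S \<inter> A = {}" "S \<inter> B = {}"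
    "A \<inter> B = {}" "A \<noteq> {}" "B \<noteq> {}" "card S < k"
  shows "\<exists>x\<in>A. \<exists>y\<in>B. {x, y} \<in> E"
  using conjunct2[OF assms(2)[unfolded k_connected_iff_cut[OF assms(1)]], rule_format, of S A B] assms(3-)
  by simp

lemma k_connected_cutI:
  assumes "simple_graph V E" "k + 1 \<le> card V"
    "\<And>S A B. S \<union> A \<union> B = V \<Longrightarrow> S \<inter> A = {} \<Longrightarrow> S \<inter> B = {} \<Longrightarrow> A \<inter> B = {} \<Longrightarrow> A \<noteq> {} \<Longrightarrow> B \<noteq> {}
       \<Longrightarrow> card S < k \<Longrightarrow> \<exists>x\<in>A. \<exists>y\<in>B. {x, y} \<in> E"
  shows "k_connected k V E"
  unfolding k_connected_iff_cut[OF assms(1)] using assms(2,3) by blast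

lemma k_connected_mono:
  assumes "k_connected k V E" "j \<le> k"
  shows "k_connected j V E"
  using assms unfolding k_connected_def by fastforce

text \<open>Otherwise the neighbourhood is a separator with fewer than \<open>k\<close> vertices: by
  \<open>k + 1 \<le> card V\<close> some vertex lies beyond it.\<close>

lemma k_connected_card_nbrs:
  assumes G: "simple_graph V E" and conn: "k_connected k V E" and v: "v \<in> V"
  shows "k \<le> card (nbrs E v)"
proof (rule ccontr)
  assume less: "\<not> ?thesis"
  have N: "nbrs E v \<subseteq> V - {v}" by (rule nbrs_subset[OF G])
  have fin: "finite (nbrs E v)" using N G unfolding simple_graph_def by (meson finite_Diff finite_subset)
  define B where "B = V - {v} - nbrs E v"
  have "B \<noteq> {}"
  proof
    assume "B = {}"
    then have "V = insert v (nbrs E v)" using N v unfolding B_def by blast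
    then have "card V \<le> Suc (card (nbrs E v))" using fin by (simp add: card_insert_if)
    with less conn show False unfolding k_connected_def by simp
  qed
  then have "\<exists>x\<in>{v}. \<exists>y\<in>B. {x, y} \<in> E"
    using N v less unfolding B_def
    by (intro k_connected_cutD[OF G conn, of "nbrs E v"]) auto
  then show False unfolding B_def nbrs_def by blast
qed

text \<open>The vertices other than \<open>x\<close> and \<open>y\<close> number only
  \<open>k - 1\<close>, so removing them must leave \<open>x\<close> and \<open>y\<close>
  joined.\<close>

lemma k_connected_min_card_complete:
  assumes G: "simple_graph V E" and conn: "k_connected k V E" and card: "card V = k + 1"
    and x: "x \<in> V" and y: "y \<in> V" and xy: "x \<noteq> y"
  shows "{x, y} \<in> E"
proof -
  have fin: "finite V" using G unfolding simple_graph_def by simp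
  have "card (V - {x, y}) = card V - card {x, y}" using x y fin by (intro card_Diff_subset) auto
  then have "card (V - {x, y}) = k - 1" using card xy by simp
  moreover have "card {x, y} \<le> card V" using x y fin by (intro card_mono) auto
  ultimately have "card (V - {x, y}) < k" using xy card by simp
  then have "\<exists>a\<in>{x}. \<exists>b\<in>{y}. {a, b} \<in> E"
    using x y xy by (intro k_connected_cutD[OF G conn, of "V - {x, y}"]) auto
  then show ?thesis by blast
qed

lemma simple_graph_delete:
  assumes "simple_graph V E"
  shows "simple_graph (V - {v}) {e \<in> E. v \<notin> e}"
  by (rule simple_graph_subset[OF assms]) (use assms in \<open>auto simp: simple_graph_def\<close>)

text \<open>A separator of the smaller graph becomes one of the whole graph when \<open>v\<close> is
  added. This costs one unit of connectivity, unlike \<open>k_connected_eliminate\<close>.\<close>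

lemma k_connected_delete:
  assumes G: "simple_graph V E" and conn: "k_connected (k + 1) V E" and v: "v \<in> V"
  shows "k_connected k (V - {v}) {e \<in> E. v \<notin> e}"
proof (rule k_connected_cutI[OF simple_graph_delete[OF G]])
  have fin: "finite V" using G unfolding simple_graph_def by simp
  then have "card (V - {v}) = card V - 1" using v by simp
  moreover have "k + 2 \<le> card V" using conn unfolding k_connected_def by simp
  ultimately show "k + 1 \<le> card (V - {v})" by linarith
  fix S A B
  assume S: "S \<union> A \<union> B = V - {v}" "S \<inter> A = {}" "S \<inter> B = {}" "A \<inter> B = {}" "A \<noteq> {}" "B \<noteq> {}" "card S < k"
  have finS: "finite S" by (rule finite_subset[OF _ fin]) (use S in blast)
  have "insert v S \<union> A \<union> B = V" using S(1) v by blast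
  moreover have "v \<notin> A" "v \<notin> B" "v \<notin> S" using S(1) by blast+
  moreover have "card (insert v S) < k + 1" using \<open>v \<notin> S\<close> S(7) finS by simp
  ultimately have "\<exists>x\<in>A. \<exists>y\<in>B. {x, y} \<in> E"
    using S by (intro k_connected_cutD[OF G conn, of "insert v S"]) auto
  then show "\<exists>x\<in>A. \<exists>y\<in>B. {x, y} \<in> {e \<in> E. v \<notin> e}" using \<open>v \<notin> A\<close> \<open>v \<notin> B\<close> by auto
qed

definition eliminate :: "'v \<Rightarrow> 'v set set \<Rightarrow> 'v set set" where
  "eliminate v E = {e \<in> E. v \<notin> e} \<union> {{x, y} | x y. x \<in> nbrs E v \<and> y \<in> nbrs E v \<and> x \<noteq> y}"

lemma simple_graph_eliminate:
  assumes "simple_graph V E"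
  shows "simple_graph (V - {v}) (eliminate v E)"
  unfolding simple_graph_def
proof (intro conjI ballI)
  show "finite (V - {v})" using assms unfolding simple_graph_def by simp
  fix e assume "e \<in> eliminate v E"
  then show "e \<subseteq> V - {v}" "card e = 2"
    using assms nbrs_subset[OF assms, of v] unfolding simple_graph_def eliminate_def
    by (auto simp: card_insert_if)
qed

text \<open>The new clique stands in for \<open>v\<close>. If \<open>v\<close> has neighbours in
  both \<open>A\<close> and \<open>B\<close>, a clique edge joins them. If it has none in
  \<open>B\<close>, adding \<open>v\<close> to \<open>A\<close> gives a separation of the old graph,
  and the crossing edge found there cannot use \<open>v\<close>.\<close>

lemma k_connected_eliminate:
  assumes G: "simple_graph V E" and conn: "k_connected k V E" and v: "v \<in> V" and card: "k + 2 \<le> card V"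
  shows "k_connected k (V - {v}) (eliminate v E)"
proof (rule k_connected_cutI[OF simple_graph_eliminate[OF G]])
  have fin: "finite V" using G unfolding simple_graph_def by simp
  show "k + 1 \<le> card (V - {v})" using card v fin by simp
  have half: "\<exists>x\<in>A. \<exists>y\<in>B. {x, y} \<in> eliminate v E"
    if S: "S \<union> A \<union> B = V - {v}" "S \<inter> A = {}" "S \<inter> B = {}" "A \<inter> B = {}" "A \<noteq> {}" "B \<noteq> {}" "card S < k"
      and NB: "nbrs E v \<inter> B = {}" for S A B
  proof -
    have vB: "v \<notin> B" using S(1) by blast
    have "\<exists>x\<in>insert v A. \<exists>y\<in>B. {x, y} \<in> E"
      using S v by (intro k_connected_cutD[OF G conn, of S]) auto
    then obtain x y where xy: "x \<in> insert v A" "y \<in> B" "{x, y} \<in> E" by blast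
    moreover have "x \<noteq> v" using xy NB unfolding nbrs_def by blast
    ultimately show ?thesis using vB unfolding eliminate_def by auto
  qed
  fix S A B
  assume S: "S \<union> A \<union> B = V - {v}" "S \<inter> A = {}" "S \<inter> B = {}" "A \<inter> B = {}" "A \<noteq> {}" "B \<noteq> {}" "card S < k"
  consider "nbrs E v \<inter> B = {}" | "nbrs E v \<inter> A = {}"
    | x y where "x \<in> nbrs E v" "x \<in> A" "y \<in> nbrs E v" "y \<in> B" by blast
  then show "\<exists>x\<in>A. \<exists>y\<in>B. {x, y} \<in> eliminate v E"
  proof cases
    case 1
    then show ?thesis using half[OF S] by blast
  next
    case 2
    have "S \<union> B \<union> A = V - {v}" "B \<inter> A = {}" using S by blast+
    with half[of S B A] S 2 have "\<exists>x\<in>B. \<exists>y\<in>A. {x, y} \<in> eliminate v E" by blast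
    then show ?thesis by (metis insert_commute)
  next
    case 3
    then have "{x, y} \<in> eliminate v E" using S unfolding eliminate_def by blast
    then show ?thesis using 3 by blast
  qed
qed

section \<open>Highly connected subgraphs of dense graphs\<close>

lemma card_edges_induced_le:
  assumes G: "simple_graph V E" and U: "U \<subseteq> V"
  shows "2 * card {e \<in> E. e \<subseteq> U} \<le> card U * (card U - 1)"
proof -
  have fin: "finite U" using G U unfolding simple_graph_def by (meson finite_subset)
  have "{e \<in> E. e \<subseteq> U} \<subseteq> {e. e \<subseteq> U \<and> card e = 2}" using G unfolding simple_graph_def by auto
  then have "card {e \<in> E. e \<subseteq> U} \<le> card {e. e \<subseteq> U \<and> card e = 2}"
    by (rule card_mono[rotated]) (use fin in auto)
  also have "\<dots> = card U choose 2" using n_subsets[OF fin] by simp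
  finally show ?thesis by (simp add: choose_two)
qed

text \<open>A vertex set \<open>U\<close> of least size with at least \<open>2k\<close> elements and more than \<open>2k(|U| - k)\<close>
  induced edges works: minimality forces large degrees, and a small cut would split \<open>U\<close> into two
  sets, at least one of which again has too many edges.\<close>

theorem mader:
  assumes G: "simple_graph V E" and k: "1 \<le> k" and "V \<noteq> {}" and edges: "2 * k * card V \<le> card E"
  shows "\<exists>U\<subseteq>V. k_connected k U {e \<in> E. e \<subseteq> U}"
proof -
  have fin: "finite V" using G unfolding simple_graph_def by simp
  have finE: "finite E" by (rule simple_graph_finite_edges[OF G])
  define ed where "ed U = {e \<in> E. e \<subseteq> U}" for U
  have fin_ed: "finite (ed U)" for U unfolding ed_def using finE by simp
  \<comment> \<open>The term \<open>2 * k * k\<close> stands on the right to avoid truncated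
    subtraction in the bound.\<close>
  define P where "P U \<longleftrightarrow> U \<subseteq> V \<and> 2 * k \<le> card U \<and> 2 * k * card U < card (ed U) + 2 * k * k" for U
  have edV: "ed V = E" unfolding ed_def using G unfolding simple_graph_def by auto
  have pos: "0 < card V" using fin \<open>V \<noteq> {}\<close> by (simp add: card_gt_0_iff)
  \<comment> \<open>So many edges force \<open>card V\<close> beyond \<open>4 * k\<close>; hence
    \<open>V\<close> itself is a candidate.\<close>
  have "2 * card E \<le> card V * (card V - 1)"
    using card_edges_induced_le[OF G, of V] edV unfolding ed_def by simp
  moreover have "card V * (4 * k) = 2 * (2 * k * card V)" by simp
  ultimately have "card V * (4 * k) \<le> card V * (card V - 1)" using edges by linarith
  then have "4 * k \<le> card V - 1" using pos by simp
  moreover have "0 < 2 * k * k" using k by simp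
  ultimately have "2 * k \<le> card V \<and> 2 * k * card V < card E + 2 * k * k" using edges by linarith
  then have "P V" unfolding P_def edV by simp
  then obtain U where U: "P U" and least: "\<And>U'. P U' \<Longrightarrow> card U \<le> card U'"
    using ex_has_least_nat[of P V card] by blast
  have UV: "U \<subseteq> V" and U2: "2 * k \<le> card U" and Ue: "2 * k * card U < card (ed U) + 2 * k * k"
    using U unfolding P_def by auto
  have finU: "finite U" using UV fin finite_subset by blast
  \<comment> \<open>On \<open>2 * k\<close> vertices the bound asks for more than
    \<open>2 * k * k\<close> edges, but only \<open>k * (2 * k - 1)\<close> fit. So one vertex can
    be removed without falling below \<open>2 * k\<close>.\<close>
  have "card U \<noteq> 2 * k"
  proof
    assume c: "card U = 2 * k"
    have "2 * card (ed U) \<le> 2 * k * (2 * k - 1)"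
      using card_edges_induced_le[OF G UV] c unfolding ed_def by simp
    then have "card (ed U) \<le> k * (2 * k - 1)" by simp
    also have "\<dots> \<le> 2 * k * k" by simp
    finally have "card (ed U) \<le> 2 * k * k" .
    moreover have "2 * k * (2 * k) < card (ed U) + 2 * k * k" using Ue c by simp
    ultimately show False by simp
  qed
  then have U3: "2 * k + 1 \<le> card U" using U2 by simp
  have notP: "card (ed U') + 2 * k * k \<le> 2 * k * card U'"
    if "U' \<subset> U" "2 * k \<le> card U'" for U'
  proof -
    have "card U' < card U" using that finU by (simp add: psubset_card_mono)
    then have "\<not> P U'" using least by (meson leD)
    then show ?thesis unfolding P_def using that UV by auto
  qed
  \<comment> \<open>Removing a vertex of degree at most \<open>2 * k\<close> lowers the bound by
    \<open>2 * k\<close> and the edge count by no more, which would leave a smaller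
    candidate.\<close>
  have deg: "2 * k < card {y\<in>U. {x, y} \<in> E}" if x: "x \<in> U" for x
  proof -
    have "card (ed (U - {x})) + 2 * k * k \<le> 2 * k * card (U - {x})"
      by (rule notP) (use x U3 finU in auto)
    then have 1: "card (ed (U - {x})) + 2 * k * k \<le> 2 * k * (card U - 1)" using x finU by simp
    have "ed U \<subseteq> ed (U - {x}) \<union> (\<lambda>y. {x, y}) ` {y\<in>U. {x, y} \<in> E}"
    proof
      fix e assume e: "e \<in> ed U"
      then have "e \<in> E" unfolding ed_def by simp
      then obtain a b where ab: "e = {a, b}" "a \<in> V" "b \<in> V" "a \<noteq> b" by (rule simple_graph_edgeE[OF G])
      with e show "e \<in> ed (U - {x}) \<union> (\<lambda>y. {x, y}) ` {y\<in>U. {x, y} \<in> E}"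
        unfolding ed_def by (auto simp: insert_commute)
    qed
    then have "card (ed U) \<le> card (ed (U - {x}) \<union> (\<lambda>y. {x, y}) ` {y\<in>U. {x, y} \<in> E})"
      by (rule card_mono[rotated]) (use fin_ed finU in auto)
    also have "\<dots> \<le> card (ed (U - {x})) + card ((\<lambda>y. {x, y}) ` {y\<in>U. {x, y} \<in> E})"
      by (rule card_Un_le)
    also have "card ((\<lambda>y. {x, y}) ` {y\<in>U. {x, y} \<in> E}) \<le> card {y\<in>U. {x, y} \<in> E}"
      by (rule card_image_le) (use finU in simp)
    finally have 2: "card (ed U) \<le> card (ed (U - {x})) + card {y\<in>U. {x, y} \<in> E}" by simp
    have "2 * k * card U = 2 * k * (card U - 1) + 2 * k" using U3 by (cases "card U") auto
    with 1 2 Ue show ?thesis by linarith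
  qed
  have "k_connected k U (ed U)"
  proof (rule k_connected_cutI)
    show "simple_graph U (ed U)" unfolding ed_def by (rule simple_graph_subset[OF G UV]) auto
    show "k + 1 \<le> card U" using U3 by simp
    fix S A B
    assume S: "S \<union> A \<union> B = U" "S \<inter> A = {}" "S \<inter> B = {}" "A \<inter> B = {}" "A \<noteq> {}" "B \<noteq> {}" "card S < k"
    show "\<exists>x\<in>A. \<exists>y\<in>B. {x, y} \<in> ed U"
    proof (rule ccontr)
      assume no: "\<not> ?thesis"
      then have no': "{x, y} \<notin> E" "{y, x} \<notin> E" if "x \<in> A" "y \<in> B" for x y
        using that S(1) unfolding ed_def by (auto simp: insert_commute)
      have finS: "finite S" "finite A" "finite B" using S(1) finU by (metis finite_Un)+
      \<comment> \<open>All neighbours of a vertex of \<open>A\<close> lie in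
        \<open>S \<union> A\<close>, so the degree bound makes this part large enough for minimality
        to apply.\<close>
      have big: "2 * k \<le> card (S \<union> A)" if "A \<noteq> {}" "A \<subseteq> U"
        "\<And>x y. x \<in> A \<Longrightarrow> y \<in> U - (S \<union> A) \<Longrightarrow> {x, y} \<notin> E" "finite A" for A
      proof -
        obtain x where x: "x \<in> A" using \<open>A \<noteq> {}\<close> by blast
        have "{y\<in>U. {x, y} \<in> E} \<subseteq> S \<union> A" using that(3)[OF x] by blast
        then have "card {y\<in>U. {x, y} \<in> E} \<le> card (S \<union> A)" using finS \<open>finite A\<close> by (simp add: card_mono)
        moreover have "2 * k < card {y\<in>U. {x, y} \<in> E}" using deg x \<open>A \<subseteq> U\<close> by blast
        ultimately show ?thesis by simp
      qed
      have bA: "2 * k \<le> card (S \<union> A)" by (rule big) (use S no' finS in auto)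
      have bB: "2 * k \<le> card (S \<union> B)" by (rule big) (use S no' finS in auto)
      have eA: "card (ed (S \<union> A)) + 2 * k * k \<le> 2 * k * card (S \<union> A)"
        by (rule notP[OF _ bA]) (use S in auto)
      have eB: "card (ed (S \<union> B)) + 2 * k * k \<le> 2 * k * card (S \<union> B)"
        by (rule notP[OF _ bB]) (use S in auto)
      have "ed U \<subseteq> ed (S \<union> A) \<union> ed (S \<union> B)"
      proof
        fix e assume e: "e \<in> ed U"
        then have "e \<in> E" unfolding ed_def by simp
        then obtain a b where ab: "e = {a, b}" "a \<in> V" "b \<in> V" "a \<noteq> b" by (rule simple_graph_edgeE[OF G])
        have "{a, b} \<in> E" "a \<in> U" "b \<in> U" using e ab unfolding ed_def by auto
        then show "e \<in> ed (S \<union> A) \<union> ed (S \<union> B)"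
          using no' S(1) ab unfolding ed_def by blast
      qed
      then have "card (ed U) \<le> card (ed (S \<union> A) \<union> ed (S \<union> B))"
        by (rule card_mono[rotated]) (use fin_ed in auto)
      then have le: "card (ed U) \<le> card (ed (S \<union> A)) + card (ed (S \<union> B))"
        using card_Un_le order_trans by blast
      have "card (S \<union> A) = card S + card A" "card (S \<union> B) = card S + card B"
        using S finS by (simp_all add: card_Un_disjoint)
      moreover have cU: "card U = card S + card A + card B"
        using S finS by (metis Int_Un_distrib2 card_Un_disjoint finite_UnI sup_bot_left)
      \<comment> \<open>The two parts overlap in \<open>S\<close> only; since
        \<open>card S < k\<close>, their edge bounds add up to at most the bound for
        \<open>U\<close>.\<close>
      moreover have "2 * k * card S \<le> 2 * k * k" using S(7) by (intro mult_le_mono2) simp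
      ultimately have "2 * k * card (S \<union> A) + 2 * k * card (S \<union> B) \<le> 2 * k * card U + 2 * k * k"
        by (simp add: distrib_left)
      with eA eB Ue le show False by linarith
    qed
  qed
  then show ?thesis using UV unfolding ed_def by blast
qed

section \<open>Germs and derivations\<close>

text \<open>Functions stand for their germs at \<open>0\<close>; the last clause says that evaluation at \<open>0\<close> is
  injective on the germs, so such a ring is a subring of \<open>\<real>\<close> whose elements are allowed to move.\<close>

definition germ_ring :: "(real \<Rightarrow> real) set \<Rightarrow> bool" where
  "germ_ring G \<longleftrightarrow>
     (\<forall>f\<in>G. f differentiable (at 0)) \<and> (\<lambda>_. 1) \<in> G \<and>
     (\<forall>f\<in>G. \<forall>g\<in>G. (\<lambda>t. f t + g t) \<in> G \<and> (\<lambda>t. f t * g t) \<in> G) \<and>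
     (\<forall>f\<in>G. (\<lambda>t. - f t) \<in> G) \<and>
     (\<forall>f\<in>G. f 0 = 0 \<longrightarrow> (\<forall>\<^sub>F t in nhds 0. f t = 0))"

text \<open>Polynomials over a germ ring, kept as families of real polynomials. The degree bound is
  uniform in \<open>t\<close>, so only finitely many coefficients have to be controlled near
  \<open>0\<close>.\<close>

definition germ_poly :: "(real \<Rightarrow> real) set \<Rightarrow> (real \<Rightarrow> real poly) \<Rightarrow> bool" where
  "germ_poly G P \<longleftrightarrow> (\<exists>n. \<forall>t. degree (P t) \<le> n) \<and> (\<forall>i. (\<lambda>t. coeff (P t) i) \<in> G)"

section \<open>Simple roots of differentiable families of polynomials\<close>

lemma poly_eq_sum_bound:
  fixes p :: "real poly"
  assumes "degree p \<le> n"
  shows "poly p x = (\<Sum>i\<le>n. coeff p i * x ^ i)"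
proof -
  have "(\<Sum>i\<le>n. coeff p i * x ^ i) = (\<Sum>i\<le>degree p. coeff p i * x ^ i)"
    by (rule sum.mono_neutral_right) (use assms in \<open>auto simp: coeff_eq_0\<close>)
  then show ?thesis by (simp add: poly_altdef)
qed

text \<open>One step of pseudo-division: cross-multiplying by the leading coefficients cancels the
  top terms without dividing, so coefficients stay in the ring they come from.\<close>

lemma degree_smult_diff_monom_less:
  fixes p q :: "real poly"
  assumes "degree q \<le> degree p" "degree p \<noteq> 0"
  shows "degree (smult (lead_coeff q) p - monom (lead_coeff p) (degree p - degree q) * q) < degree p"
    (is "degree ?r < _")
proof (cases "?r = 0")
  case False
  show ?thesis
  proof (rule degree_less_if_less_eqI)
    show "degree ?r \<le> degree p"
    proof (rule degree_diff_le)
      show "degree (monom (lead_coeff p) (degree p - degree q) * q) \<le> degree p"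
        using degree_mult_le[of "monom (lead_coeff p) (degree p - degree q)" q]
          degree_monom_le[of "lead_coeff p" "degree p - degree q"] assms by linarith
    qed (rule degree_smult_le)
  qed (use assms False in \<open>auto simp: coeff_monom_mult\<close>)
qed (use assms in simp)

lemma tendsto_poly_family:
  fixes P :: "'a \<Rightarrow> real poly"
  assumes "\<And>t. degree (P t) \<le> n" "degree p \<le> n"
    "\<And>i. ((\<lambda>t. coeff (P t) i) \<longlongrightarrow> coeff p i) F" "(x \<longlongrightarrow> y) F"
  shows "((\<lambda>t. poly (P t) (x t)) \<longlongrightarrow> poly p y) F"
  unfolding poly_eq_sum_bound[OF assms(1)] poly_eq_sum_bound[OF assms(2)]
  by (intro tendsto_intros assms)

lemma tendsto_at_imp_nhds:
  assumes "isCont f a"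
  shows "(f \<longlongrightarrow> f a) (nhds a)"
  using assms unfolding isCont_def tendsto_at_iff_tendsto_nhds .

context
  fixes M :: "real \<Rightarrow> real poly" and n :: nat and y :: real
  assumes deg: "\<And>t. degree (M t) \<le> n"
    and diff: "\<And>i. (\<lambda>t. coeff (M t) i) differentiable (at 0)"
    and root: "poly (M 0) y = 0"
begin

lemma coeff_tendsto: "((\<lambda>t. coeff (M t) i) \<longlongrightarrow> coeff (M 0) i) (nhds 0)"
  using differentiable_imp_continuous_within[OF diff, of i] by (rule tendsto_at_imp_nhds)

lemma pderiv_family_tendsto:
  assumes "(s \<longlongrightarrow> 0) F" "(x \<longlongrightarrow> y) F"
  shows "((\<lambda>t. poly (pderiv (M (s t))) (x t)) \<longlongrightarrow> poly (pderiv (M 0)) y) F"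
proof (rule tendsto_poly_family)
  show "degree (pderiv (M (s t))) \<le> n" for t using deg[of "s t"] by (simp add: degree_pderiv)
  show "degree (pderiv (M 0)) \<le> n" using deg[of 0] by (simp add: degree_pderiv)
  show "((\<lambda>t. coeff (pderiv (M (s t))) i) \<longlongrightarrow> coeff (pderiv (M 0)) i) F" for i
    unfolding coeff_pderiv
    by (intro tendsto_intros filterlim_compose[OF coeff_tendsto] assms)
qed (fact assms)

text \<open>An implicit function theorem for coefficients that are differentiable at the single
  point \<open>0\<close>. Near \<open>(0, y)\<close> the slope in \<open>x\<close> stays above
  \<open>c\<close>, so the intermediate value theorem gives a root close to \<open>y\<close>, and
  the mean value theorem expresses its displacement by \<open>g\<close>.\<close>

lemma implicit_root_pos:
  assumes pos: "poly (pderiv (M 0)) y > 0"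
  shows "\<exists>Y. Y 0 = y \<and> Y differentiable (at 0) \<and> (\<forall>\<^sub>F t in nhds 0. poly (M t) (Y t) = 0)"
proof -
  define c where "c = poly (pderiv (M 0)) y / 2"
  have c: "c > 0" using pos unfolding c_def by simp
  define g where "g t = poly (M t) y" for t
  have g0: "g 0 = 0" using root unfolding g_def .
  have g_diff: "g differentiable (at 0)"
    unfolding g_def poly_eq_sum_bound[OF deg]
    by (intro differentiable_sum differentiable_mult differentiable_const diff ballI finite_atMost)
  have "((\<lambda>z. poly (pderiv (M (fst z))) (snd z)) \<longlongrightarrow> poly (pderiv (M 0)) y) (nhds 0 \<times>\<^sub>F nhds y)"
    by (intro pderiv_family_tendsto filterlim_fst filterlim_snd)
  then have "\<forall>\<^sub>F z in nhds 0 \<times>\<^sub>F nhds y. c < poly (pderiv (M (fst z))) (snd z)"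
    by (rule order_tendstoD) (use pos in \<open>simp add: c_def\<close>)
  then obtain P Q where PQ: "eventually P (nhds 0)" "eventually Q (nhds y)"
      "\<And>t x. P t \<Longrightarrow> Q x \<Longrightarrow> c < poly (pderiv (M t)) x"
    unfolding eventually_prod_filter by auto
  obtain \<delta>1 \<delta>2 where "\<delta>1 > 0" "\<delta>2 > 0" "\<And>t. dist t 0 < \<delta>1 \<Longrightarrow> P t" "\<And>x. dist x y < \<delta>2 \<Longrightarrow> Q x"
    using PQ(1,2) unfolding eventually_nhds_metric by blast
  then obtain \<delta> where "\<delta> > 0" and d: "\<And>t x. dist t 0 < \<delta> \<Longrightarrow> dist x y < \<delta> \<Longrightarrow> c < poly (pderiv (M t)) x"
    using that[of "min \<delta>1 \<delta>2"] PQ(3) by auto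
  define \<eta> where "\<eta> = \<delta> / 2"
  have eta: "0 < \<eta>" "\<eta> < \<delta>" using \<open>\<delta> > 0\<close> unfolding \<eta>_def by auto
  have slope: "c < poly (pderiv (M t)) x" if "\<bar>t\<bar> < \<delta>" "\<bar>x - y\<bar> \<le> \<eta>" for t x
    by (rule d) (use that eta in \<open>auto simp: dist_real_def\<close>)
  have mvt: "\<exists>\<xi>. \<bar>\<xi> - y\<bar> \<le> \<bar>x - y\<bar> \<and> poly (M t) x - g t = (x - y) * poly (pderiv (M t)) \<xi>" for t x
  proof (cases x y rule: linorder_cases)
    case less
    then obtain \<xi> where "x < \<xi>" "\<xi> < y" "poly (M t) y - poly (M t) x = (y - x) * poly (pderiv (M t)) \<xi>"
      using poly_MVT by blast
    then show ?thesis unfolding g_def by (intro exI[of _ \<xi>]) (auto simp: algebra_simps)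
  next
    case greater
    then obtain \<xi> where "y < \<xi>" "\<xi> < x" "poly (M t) x - poly (M t) y = (x - y) * poly (pderiv (M t)) \<xi>"
      using poly_MVT by blast
    then show ?thesis unfolding g_def by (intro exI[of _ \<xi>]) auto
  qed (auto simp: g_def)
  have g_lim: "(g \<longlongrightarrow> 0) (nhds 0)"
    using tendsto_at_imp_nhds[OF differentiable_imp_continuous_within[OF g_diff]] g0 by simp
  have small: "\<forall>\<^sub>F t in nhds 0. \<bar>g t\<bar> < c * \<eta>"
    using order_tendstoD(2)[OF tendsto_rabs[OF g_lim], of "c * \<eta>"] c eta by simp
  have near: "\<forall>\<^sub>F t in nhds 0. \<bar>t\<bar> < \<delta>"
    using \<open>\<delta> > 0\<close> unfolding eventually_nhds_metric by (auto simp: dist_real_def)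
  have ex: "\<forall>\<^sub>F t in nhds 0. \<exists>x. \<bar>x - y\<bar> \<le> \<eta> \<and> poly (M t) x = 0"
    using small near
  proof eventually_elim
    case (elim t)
    obtain \<xi>1 where x1: "\<bar>\<xi>1 - y\<bar> \<le> \<eta>" "poly (M t) (y + \<eta>) - g t = \<eta> * poly (pderiv (M t)) \<xi>1"
      using mvt[of "y + \<eta>" t] eta by auto
    obtain \<xi>2 where x2: "\<bar>\<xi>2 - y\<bar> \<le> \<eta>" "poly (M t) (y - \<eta>) - g t = - \<eta> * poly (pderiv (M t)) \<xi>2"
      using mvt[of "y - \<eta>" t] eta by auto
    have "\<eta> * c < \<eta> * poly (pderiv (M t)) \<xi>1" "\<eta> * c < \<eta> * poly (pderiv (M t)) \<xi>2"
      using slope[OF elim(2) x1(1)] slope[OF elim(2) x2(1)] eta by auto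
    then have "0 < poly (M t) (y + \<eta>)" "poly (M t) (y - \<eta>) < 0"
      using x1 x2 elim(1) by (auto simp: algebra_simps abs_less_iff)
    then obtain x where "y - \<eta> < x" "x < y + \<eta>" "poly (M t) x = 0"
      using poly_IVT_pos[of "y - \<eta>" "y + \<eta>" "M t"] eta by auto
    then show ?case by (intro exI[of _ x]) auto
  qed
  define Y where "Y t = (SOME x. \<bar>x - y\<bar> \<le> \<eta> \<and> poly (M t) x = 0)" for t
  have Y: "\<forall>\<^sub>F t in nhds 0. \<bar>Y t - y\<bar> \<le> \<eta> \<and> poly (M t) (Y t) = 0"
    using ex by eventually_elim (unfold Y_def, rule someI_ex)
  have "\<forall>t. \<exists>\<xi>. \<bar>\<xi> - y\<bar> \<le> \<bar>Y t - y\<bar> \<and> poly (M t) (Y t) - g t = (Y t - y) * poly (pderiv (M t)) \<xi>"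
    using mvt by blast
  from choice[OF this] obtain \<xi> where \<xi>: "\<And>t. \<bar>\<xi> t - y\<bar> \<le> \<bar>Y t - y\<bar>"
    "\<And>t. poly (M t) (Y t) - g t = (Y t - y) * poly (pderiv (M t)) (\<xi> t)"
    by blast
  \<comment> \<open>Both continuity and differentiability of \<open>Y\<close> at \<open>0\<close>
    are read off from this formula: \<open>g t / t\<close> tends to the derivative of
    \<open>g\<close>, and the slopes tend to the slope at \<open>y\<close> once \<open>bound\<close>
    has forced \<open>\<xi>\<close> to \<open>y\<close>.\<close>
  have key: "\<forall>\<^sub>F t in nhds 0. c < poly (pderiv (M t)) (\<xi> t) \<and> Y t - y = - g t / poly (pderiv (M t)) (\<xi> t)"
    using Y near
  proof eventually_elim
    case (elim t)
    have "c < poly (pderiv (M t)) (\<xi> t)" using slope[OF elim(2)] \<xi>(1)[of t] elim(1) by auto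
    moreover from this have "Y t - y = - g t / poly (pderiv (M t)) (\<xi> t)"
      using \<xi>(2)[of t] elim(1) c by (simp add: field_simps)
    ultimately show ?case ..
  qed
  have bound: "\<forall>\<^sub>F t in nhds 0. \<bar>Y t - y\<bar> \<le> \<bar>g t\<bar> / c"
    using key
  proof eventually_elim
    case (elim t)
    then have "\<bar>Y t - y\<bar> = \<bar>g t\<bar> / poly (pderiv (M t)) (\<xi> t)" using c by simp
    also have "\<dots> \<le> \<bar>g t\<bar> / c" using elim c by (intro divide_left_mono) auto
    finally show ?case .
  qed
  have Y0: "Y 0 = y" using eventually_nhds_x_imp_x[OF bound] g0 by simp
  have "((\<lambda>t. \<bar>Y t - y\<bar>) \<longlongrightarrow> 0) (nhds 0)"
  proof (rule tendsto_sandwich[OF _ bound tendsto_const])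
    show "((\<lambda>t. \<bar>g t\<bar> / c) \<longlongrightarrow> 0) (nhds 0)"
      using tendsto_divide[OF tendsto_rabs[OF g_lim] tendsto_const[of c]] c by simp
  qed simp
  then have "((\<lambda>t. \<bar>\<xi> t - y\<bar>) \<longlongrightarrow> 0) (nhds 0)"
    by (rule tendsto_sandwich[OF _ _ tendsto_const, rotated 2]) (use \<xi>(1) in auto)
  then have \<xi>_lim: "(\<xi> \<longlongrightarrow> y) (nhds 0)"
    by (simp add: tendsto_rabs_zero_iff LIM_zero_iff)
  obtain g' where g': "(g has_real_derivative g') (at 0)"
    using g_diff real_differentiable_def by blast
  have "((\<lambda>t. g t / t) \<longlongrightarrow> g') (at 0)"
    using g' g0 unfolding has_field_derivative_iff by simp
  moreover have "((\<lambda>t. poly (pderiv (M t)) (\<xi> t)) \<longlongrightarrow> poly (pderiv (M 0)) y) (at 0)"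
    using pderiv_family_tendsto[OF filterlim_ident \<xi>_lim] filterlim_mono at_within_le_nhds by blast
  ultimately have "((\<lambda>t. - (g t / t) / poly (pderiv (M t)) (\<xi> t)) \<longlongrightarrow> - g' / poly (pderiv (M 0)) y) (at 0)"
    using pos by (intro tendsto_intros) auto
  moreover have "\<forall>\<^sub>F t in at 0. - (g t / t) / poly (pderiv (M t)) (\<xi> t) = (Y t - Y 0) / t"
    using filter_leD[OF at_within_le_nhds key] by eventually_elim (simp add: Y0)
  ultimately have "((\<lambda>t. (Y t - Y 0) / t) \<longlongrightarrow> - g' / poly (pderiv (M 0)) y) (at 0)"
    by (rule Lim_transform_eventually)
  then have "(Y has_real_derivative - g' / poly (pderiv (M 0)) y) (at 0)"
    unfolding has_field_derivative_iff by simp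
  then have "Y differentiable (at 0)" using real_differentiable_def by blast
  moreover have "\<forall>\<^sub>F t in nhds 0. poly (M t) (Y t) = 0" using Y by eventually_elim simp
  ultimately show ?thesis using Y0 by blast
qed

end

lemma implicit_root:
  fixes M :: "real \<Rightarrow> real poly"
  assumes "\<And>t. degree (M t) \<le> n" "\<And>i. (\<lambda>t. coeff (M t) i) differentiable (at 0)"
    "poly (M 0) y = 0" "poly (pderiv (M 0)) y \<noteq> 0"
  shows "\<exists>Y. Y 0 = y \<and> Y differentiable (at 0) \<and> (\<forall>\<^sub>F t in nhds 0. poly (M t) (Y t) = 0)"
proof (cases "poly (pderiv (M 0)) y > 0")
  case True
  then show ?thesis using implicit_root_pos assms by blast
next
  case False
  have "\<exists>Y. Y 0 = y \<and> Y differentiable (at 0) \<and> (\<forall>\<^sub>F t in nhds 0. poly (- M t) (Y t) = 0)"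
    by (rule implicit_root_pos[of _ n]) (use assms False in \<open>auto simp: pderiv_minus\<close>)
  then show ?thesis by simp
qed

section \<open>Germ rings and their extensions\<close>

context
  fixes G :: "(real \<Rightarrow> real) set"
  assumes G: "germ_ring G"
begin

lemma germ_ring_closed:
  "f \<in> G \<Longrightarrow> g \<in> G \<Longrightarrow> (\<lambda>t. f t + g t) \<in> G"
  "f \<in> G \<Longrightarrow> g \<in> G \<Longrightarrow> (\<lambda>t. f t * g t) \<in> G"
  "f \<in> G \<Longrightarrow> (\<lambda>t. - f t) \<in> G"
  "(\<lambda>_. 1) \<in> G"
  "f \<in> G \<Longrightarrow> f differentiable (at 0)"
  "f \<in> G \<Longrightarrow> f 0 = 0 \<Longrightarrow> \<forall>\<^sub>F t in nhds 0. f t = 0"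
  using G unfolding germ_ring_def by blast+

lemma germ_ring_diff: "f \<in> G \<Longrightarrow> g \<in> G \<Longrightarrow> (\<lambda>t. f t - g t) \<in> G"
  using germ_ring_closed(1)[OF _ germ_ring_closed(3), of f g] by simp

lemma germ_ring_0: "(\<lambda>_. 0) \<in> G"
  using germ_ring_diff[OF germ_ring_closed(4,4)] by simp

lemma germ_ring_sum:
  assumes "\<And>i. i \<in> A \<Longrightarrow> f i \<in> G"
  shows "(\<lambda>t. \<Sum>i\<in>A. f i t) \<in> G"
  using assms
proof (induction A rule: infinite_finite_induct)
  case (insert i A)
  then show ?case using germ_ring_closed(1)[of "f i" "\<lambda>t. \<Sum>i\<in>A. f i t"] by simp
qed (auto intro: germ_ring_0)

lemma germ_ring_of_nat: "(\<lambda>_. of_nat n) \<in> G"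
  using germ_ring_sum[of "{..<n}" "\<lambda>_ _. 1"] germ_ring_closed(4) by simp

lemma germ_poly_const:
  assumes "f \<in> G"
  shows "germ_poly G (\<lambda>t. [:f t:])"
  unfolding germ_poly_def
proof (intro conjI allI exI)
  show "(\<lambda>t. coeff [:f t:] i) \<in> G" for i
    using assms germ_ring_0 by (cases i) auto
  show "degree [:f t:] \<le> 0" for t by simp
qed

lemma germ_poly_var: "germ_poly G (\<lambda>t. [:0, 1:])"
  unfolding germ_poly_def
proof (intro conjI allI exI)
  show "(\<lambda>t. coeff [:0, 1:] i) \<in> G" for i
    using germ_ring_0 germ_ring_closed(4) by (cases i rule: nat.exhaust) (auto simp: coeff_pCons split: nat.split)
qed (rule order_refl)

lemma germ_poly_add:
  assumes "germ_poly G P" "germ_poly G Q"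
  shows "germ_poly G (\<lambda>t. P t + Q t)"
proof -
  obtain m n where mn: "\<And>t. degree (P t) \<le> m" "\<And>t. degree (Q t) \<le> n"
    using assms unfolding germ_poly_def by blast
  have "degree (P t + Q t) \<le> max m n" for t
    by (rule degree_add_le) (simp_all add: le_max_iff_disj mn)
  then show ?thesis using assms germ_ring_closed(1) unfolding germ_poly_def by auto
qed

lemma germ_poly_uminus: "germ_poly G P \<Longrightarrow> germ_poly G (\<lambda>t. - P t)"
  unfolding germ_poly_def using germ_ring_closed(3) by auto

lemma germ_poly_diff: "germ_poly G P \<Longrightarrow> germ_poly G Q \<Longrightarrow> germ_poly G (\<lambda>t. P t - Q t)"
  using germ_poly_add[OF _ germ_poly_uminus, of P Q] by simp

lemma germ_poly_mult:
  assumes "germ_poly G P" "germ_poly G Q"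
  shows "germ_poly G (\<lambda>t. P t * Q t)"
proof -
  obtain m n where mn: "\<And>t. degree (P t) \<le> m" "\<And>t. degree (Q t) \<le> n"
    using assms unfolding germ_poly_def by blast
  have "degree (P t * Q t) \<le> m + n" for t
    using degree_mult_le[of "P t" "Q t"] mn[of t] by linarith
  moreover have "(\<lambda>t. coeff (P t * Q t) i) \<in> G" for i
    unfolding coeff_mult using assms unfolding germ_poly_def
    by (intro germ_ring_sum germ_ring_closed(2)) auto
  ultimately show ?thesis unfolding germ_poly_def by blast
qed

lemma germ_poly_monom:
  assumes "f \<in> G"
  shows "germ_poly G (\<lambda>t. monom (f t) k)"
  unfolding germ_poly_def
proof (intro conjI allI exI)
  show "(\<lambda>t. coeff (monom (f t) k) i) \<in> G" for i
    using assms germ_ring_0 by (cases "k = i") auto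
  show "degree (monom (f t) k) \<le> k" for t by (rule degree_monom_le)
qed

lemma germ_poly_pderiv:
  assumes "germ_poly G P"
  shows "germ_poly G (\<lambda>t. pderiv (P t))"
proof -
  obtain m where m: "\<And>t. degree (P t) \<le> m"
    using assms unfolding germ_poly_def by blast
  have "degree (pderiv (P t)) \<le> m" for t using m[of t] by (simp add: degree_pderiv)
  then show ?thesis using assms unfolding germ_poly_def coeff_pderiv
    by (auto intro!: germ_ring_closed(2) germ_ring_of_nat simp del: of_nat_Suc)
qed

lemma germ_poly_eventually_0:
  assumes "germ_poly G P" "P 0 = 0"
  shows "\<forall>\<^sub>F t in nhds 0. P t = 0"
proof -
  obtain m where m: "\<And>t. degree (P t) \<le> m"
    using assms unfolding germ_poly_def by blast
  have "\<forall>\<^sub>F t in nhds 0. \<forall>i\<in>{..m}. coeff (P t) i = 0"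
  proof (rule eventually_ball_finite)
    show "\<forall>i\<in>{..m}. \<forall>\<^sub>F t in nhds 0. coeff (P t) i = 0"
    proof
      fix i
      have "(\<lambda>t. coeff (P t) i) \<in> G" using assms unfolding germ_poly_def by blast
      then show "\<forall>\<^sub>F t in nhds 0. coeff (P t) i = 0" by (rule germ_ring_closed(6)) (simp add: assms)
    qed
  qed simp
  then show ?thesis
  proof eventually_elim
    case (elim t)
    show ?case
    proof (rule poly_eqI)
      fix i show "coeff (P t) i = coeff 0 i"
        using elim m[of t] by (cases "i \<le> m") (auto simp: coeff_eq_0)
    qed
  qed
qed

text \<open>The new ring consists of the polynomials in \<open>Y\<close> over \<open>G\<close>. The
  assumption \<open>root\<close> is what keeps evaluation at \<open>0\<close> injective on
  it.\<close>

lemma germ_ring_adjoin: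
  assumes Y: "Y differentiable (at 0)"
    and root: "\<And>P. germ_poly G P \<Longrightarrow> poly (P 0) (Y 0) = 0 \<Longrightarrow> \<forall>\<^sub>F t in nhds 0. poly (P t) (Y t) = 0"
  shows "\<exists>H. germ_ring H \<and> G \<subseteq> H \<and> Y \<in> H"
proof -
  define H where "H = {\<lambda>t. poly (P t) (Y t) | P. germ_poly G P}"
  have HI: "(\<lambda>t. poly (P t) (Y t)) \<in> H" if "germ_poly G P" for P
    using that unfolding H_def by blast
  have GH: "G \<subseteq> H"
  proof
    fix f assume "f \<in> G"
    from HI[OF germ_poly_const[OF this]] show "f \<in> H" by simp
  qed
  have "germ_ring H"
    unfolding germ_ring_def
  proof (intro conjI ballI impI)
    fix f assume "f \<in> H"
    then obtain P where P: "germ_poly G P" "f = (\<lambda>t. poly (P t) (Y t))" unfolding H_def by blast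
    then obtain n where n: "\<And>t. degree (P t) \<le> n" "\<And>i. (\<lambda>t. coeff (P t) i) \<in> G"
      unfolding germ_poly_def by blast
    show "f differentiable (at 0)"
      unfolding P(2) poly_eq_sum_bound[OF n(1)]
      by (intro differentiable_sum differentiable_mult differentiable_power Y germ_ring_closed(5)[OF n(2)] ballI finite_atMost)
    show "(\<lambda>t. - f t) \<in> H" using HI[OF germ_poly_uminus[OF P(1)]] P(2) by simp
    show "\<forall>\<^sub>F t in nhds 0. f t = 0" if "f 0 = 0" using root[OF P(1)] that P(2) by simp
    fix g assume "g \<in> H"
    then obtain Q where Q: "germ_poly G Q" "g = (\<lambda>t. poly (Q t) (Y t))" unfolding H_def by blast
    show "(\<lambda>t. f t + g t) \<in> H" using HI[OF germ_poly_add[OF P(1) Q(1)]] P(2) Q(2) by simp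
    show "(\<lambda>t. f t * g t) \<in> H" using HI[OF germ_poly_mult[OF P(1) Q(1)]] P(2) Q(2) by simp
  next
    show "(\<lambda>_. 1) \<in> H" using GH germ_ring_closed(4) by blast
  qed
  moreover have "Y \<in> H" using HI[OF germ_poly_var] by simp
  ultimately show ?thesis using GH by blast
qed

text \<open>If \<open>y\<close> satisfies no relation over the values of \<open>G\<close>, the
  constant germ can be adjoined. Otherwise the germ must follow a relation \<open>M\<close> of least
  degree: its root \<open>y\<close> is simple and so persists as a germ \<open>Y\<close>, and by
  pseudo-division every other relation follows from \<open>M\<close>.\<close>

lemma germ_ring_extend: "\<exists>H Y. germ_ring H \<and> G \<subseteq> H \<and> Y \<in> H \<and> Y 0 = y"
proof (cases "\<exists>M. germ_poly G M \<and> M 0 \<noteq> 0 \<and> poly (M 0) y = 0")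
  case False
  have "\<exists>H. germ_ring H \<and> G \<subseteq> H \<and> (\<lambda>_. y) \<in> H"
  proof (rule germ_ring_adjoin)
    fix P assume "germ_poly G P" "poly (P 0) y = 0"
    then have "P 0 = 0" using False by blast
    with germ_poly_eventually_0[OF \<open>germ_poly G P\<close>]
    show "\<forall>\<^sub>F t in nhds 0. poly (P t) y = 0" by (auto elim: eventually_mono)
  qed simp
  then show ?thesis by blast
next
  case True
  define rel where "rel M \<longleftrightarrow> germ_poly G M \<and> M 0 \<noteq> 0 \<and> poly (M 0) y = 0" for M
  obtain M where M: "rel M" and least: "\<And>P. rel P \<Longrightarrow> degree (M 0) \<le> degree (P 0)"
    using ex_has_least_nat[of rel _ "\<lambda>M. degree (M 0)"] True unfolding rel_def by blast
  have M': "germ_poly G M" "M 0 \<noteq> 0" "poly (M 0) y = 0" using M unfolding rel_def by auto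
  have deg: "degree (M 0) \<noteq> 0"
  proof
    assume "degree (M 0) = 0"
    then obtain c where "M 0 = [:c:]" by (rule degree_eq_zeroE)
    with M' show False by simp
  qed
  \<comment> \<open>In characteristic 0 the derivative of \<open>M\<close> would otherwise be a
    nonzero relation of smaller degree.\<close>
  have simple: "poly (pderiv (M 0)) y \<noteq> 0"
  proof
    assume "poly (pderiv (M 0)) y = 0"
    then have "rel (\<lambda>t. pderiv (M t))"
      unfolding rel_def using germ_poly_pderiv[OF M'(1)] deg by (simp add: pderiv_eq_0_iff)
    from least[OF this] show False using deg by (simp add: degree_pderiv)
  qed
  obtain n where n: "\<And>t. degree (M t) \<le> n" "\<And>i. (\<lambda>t. coeff (M t) i) \<in> G"
    using M'(1) unfolding germ_poly_def by blast
  obtain Y where Y: "Y 0 = y" "Y differentiable (at 0)" "\<forall>\<^sub>F t in nhds 0. poly (M t) (Y t) = 0"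
    using implicit_root[OF n(1) germ_ring_closed(5)[OF n(2)] M'(3) simple] by blast
  define m where "m = degree (M 0)"
  \<comment> \<open>Pseudo-division multiplies by this coefficient, which can be cancelled near
    \<open>0\<close>.\<close>
  have lead: "\<forall>\<^sub>F t in nhds 0. coeff (M t) m \<noteq> 0"
  proof -
    have "isCont (\<lambda>t. coeff (M t) m) 0"
      using differentiable_imp_continuous_within[OF germ_ring_closed(5)[OF n(2)]] by simp
    then show ?thesis
      using tendsto_imp_eventually_ne[OF tendsto_at_imp_nhds] M'(2) unfolding m_def by fastforce
  qed
  have rel_eq: "\<forall>\<^sub>F t in nhds 0. poly (P t) (Y t) = 0" if "germ_poly G P" "poly (P 0) y = 0" for P
    using that
  proof (induction "degree (P 0)" arbitrary: P rule: less_induct)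
    case less
    have zero: ?case if "germ_poly G Q" "Q 0 = 0" "\<And>t. Q t = P t" for Q
      using germ_poly_eventually_0[OF that(1,2)] by eventually_elim (simp add: that(3)[symmetric])
    show ?case
    proof (cases "P 0 = 0")
      case True
      then show ?thesis using zero less.prems by blast
    next
      case False
      then have mk: "m \<le> degree (P 0)"
        using least[of P] less.prems unfolding rel_def m_def by blast
      define k where "k = degree (P 0)"
      define Q where "Q t = smult (coeff (M t) m) (P t) - monom (coeff (P t) k) (k - m) * M t" for t
      have Pc: "(\<lambda>t. coeff (P t) k) \<in> G" using less.prems unfolding germ_poly_def by blast
      have "germ_poly G (\<lambda>t. [:coeff (M t) m:] * P t - monom (coeff (P t) k) (k - m) * M t)"
        by (intro germ_poly_diff germ_poly_mult germ_poly_const germ_poly_monom less.prems n(2) M'(1) Pc)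
      then have "germ_poly G Q" unfolding Q_def by simp
      moreover have "poly (Q 0) y = 0" unfolding Q_def using less.prems M'(3) by simp
      moreover have "degree (Q 0) < degree (P 0)"
        unfolding Q_def k_def m_def
        by (rule degree_smult_diff_monom_less) (use mk deg in \<open>auto simp: m_def\<close>)
      ultimately have "\<forall>\<^sub>F t in nhds 0. poly (Q t) (Y t) = 0" using less.hyps by blast
      then show ?thesis using lead Y(3)
        by eventually_elim (simp add: Q_def)
    qed
  qed
  have "\<exists>H. germ_ring H \<and> G \<subseteq> H \<and> Y \<in> H"
    by (rule germ_ring_adjoin) (use Y rel_eq in auto)
  then show ?thesis using Y(1) by blast
qed

end

text \<open>By Zorn's lemma, every germ ring is contained in one in which each real number is the value
  at \<open>0\<close> of exactly one germ.\<close>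

lemma germ_section:
  assumes G: "germ_ring G"
  obtains \<Phi> where "\<And>a. \<Phi> a differentiable (at 0)" "\<And>a. \<Phi> a 0 = a"
    "\<And>a b. \<forall>\<^sub>F t in nhds 0. \<Phi> (a + b) t = \<Phi> a t + \<Phi> b t"
    "\<And>a b. \<forall>\<^sub>F t in nhds 0. \<Phi> (a * b) t = \<Phi> a t * \<Phi> b t"
    "\<And>f. f \<in> G \<Longrightarrow> \<forall>\<^sub>F t in nhds 0. \<Phi> (f 0) t = f t"
proof -
  define A where "A = {H. germ_ring H \<and> G \<subseteq> H}"
  have "\<exists>M\<in>A. \<forall>X\<in>A. M \<subseteq> X \<longrightarrow> X = M"
  proof (rule subset_Zorn_nonempty)
    show "A \<noteq> {}" using G unfolding A_def by blast
    fix C assume C: "C \<noteq> {}" "subset.chain A C"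
    have gr: "germ_ring H" "G \<subseteq> H" if "H \<in> C" for H
      using C(2) that unfolding A_def subset.chain_def by auto
    have two: "\<exists>H\<in>C. f \<in> H \<and> g \<in> H" if fg: "f \<in> \<Union>C" "g \<in> \<Union>C" for f g
    proof -
      obtain H K where HK: "H \<in> C" "f \<in> H" "K \<in> C" "g \<in> K" using fg by blast
      then have "H \<subseteq> K \<or> K \<subseteq> H" using C(2) unfolding subset_chain_def by blast
      then show ?thesis using HK by blast
    qed
    have "germ_ring (\<Union>C)"
      unfolding germ_ring_def
    proof (intro conjI ballI impI)
      fix f assume f: "f \<in> \<Union>C"
      then obtain H where H: "H \<in> C" "f \<in> H" by blast
      note cl = germ_ring_closed[OF gr(1)]
      show "f differentiable (at 0)" using cl(5)[OF H] .
      show "(\<lambda>t. - f t) \<in> \<Union>C" using cl(3)[OF H] H(1) by blast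
      show "\<forall>\<^sub>F t in nhds 0. f t = 0" if "f 0 = 0" using cl(6)[OF H that] .
      fix g assume "g \<in> \<Union>C"
      with two[OF f] obtain K where K: "K \<in> C" "f \<in> K" "g \<in> K" by blast
      show "(\<lambda>t. f t + g t) \<in> \<Union>C" using cl(1)[OF K] K(1) by blast
      show "(\<lambda>t. f t * g t) \<in> \<Union>C" using cl(2)[OF K] K(1) by blast
    next
      show "(\<lambda>_. 1) \<in> \<Union>C" using C(1) germ_ring_closed(4)[OF gr(1)] by blast
    qed
    moreover have "G \<subseteq> \<Union>C" using C(1) gr(2) by blast
    ultimately show "\<Union>C \<in> A" unfolding A_def by blast
  qed
  then obtain M where "M \<in> A" and mx: "\<And>X. X \<in> A \<Longrightarrow> M \<subseteq> X \<Longrightarrow> X = M" by blast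
  then have M: "germ_ring M" "G \<subseteq> M" unfolding A_def by auto
  have max: "H = M" if "germ_ring H" "M \<subseteq> H" for H
    by (rule mx) (use that M(2) in \<open>auto simp: A_def\<close>)
  \<comment> \<open>A missing value could be adjoined by \<open>germ_ring_extend\<close>, against
    maximality.\<close>
  have "\<forall>a. \<exists>f. f \<in> M \<and> f 0 = a"
  proof
    fix a
    obtain H Y where "germ_ring H" "M \<subseteq> H" "Y \<in> H" "Y 0 = a"
      using germ_ring_extend[OF M(1)] by blast
    then show "\<exists>f. f \<in> M \<and> f 0 = a" using max[of H] by auto
  qed
  from choice[OF this] obtain \<Phi> where Phi: "\<And>a. \<Phi> a \<in> M" "\<And>a. \<Phi> a 0 = a" by blast
  have eq: "\<forall>\<^sub>F t in nhds 0. f t = g t" if "f \<in> M" "g \<in> M" "f 0 = g 0" for f g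
    using germ_ring_closed(6)[OF M(1) germ_ring_diff[OF M(1) that(1,2)]] that(3) by simp
  note cl = germ_ring_closed[OF M(1)]
  show ?thesis
  proof (rule that)
    show "\<Phi> a differentiable (at 0)" for a using cl(5) Phi(1) by blast
    show "\<forall>\<^sub>F t in nhds 0. \<Phi> (a + b) t = \<Phi> a t + \<Phi> b t" for a b
      by (rule eq) (auto simp: Phi cl)
    show "\<forall>\<^sub>F t in nhds 0. \<Phi> (a * b) t = \<Phi> a t * \<Phi> b t" for a b
      by (rule eq) (auto simp: Phi cl)
    show "\<forall>\<^sub>F t in nhds 0. \<Phi> (f 0) t = f t" if "f \<in> G" for f
      by (rule eq) (use that M(2) in \<open>auto simp: Phi\<close>)
  qed (fact Phi(2))
qed

section \<open>Derivations of the reals\<close>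

definition derivation :: "(real \<Rightarrow> real) \<Rightarrow> bool" where
  "derivation D \<longleftrightarrow> (\<forall>a b. D (a + b) = D a + D b) \<and> (\<forall>a b. D (a * b) = D a * b + a * D b)"

text \<open>The section \<open>\<Phi>\<close> respects sums and products up to germs, so
  differentiating it at \<open>0\<close> gives the derivation; \<open>\<Phi> a 0 = a\<close> turns
  the product rule into the Leibniz rule.\<close>

lemma germ_ring_derivation:
  assumes G: "germ_ring G"
  obtains D where "derivation D" "\<And>f. f \<in> G \<Longrightarrow> (f has_real_derivative D (f 0)) (at 0)"
proof -
  obtain \<Phi> where diff: "\<And>a. \<Phi> a differentiable (at 0)" and val: "\<And>a. \<Phi> a 0 = a"
    and add: "\<And>a b. \<forall>\<^sub>F t in nhds 0. \<Phi> (a + b) t = \<Phi> a t + \<Phi> b t"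
    and mult: "\<And>a b. \<forall>\<^sub>F t in nhds 0. \<Phi> (a * b) t = \<Phi> a t * \<Phi> b t"
    and on_G: "\<And>f. f \<in> G \<Longrightarrow> \<forall>\<^sub>F t in nhds 0. \<Phi> (f 0) t = f t"
    using germ_section[OF G] by blast
  define D where "D a = deriv (\<Phi> a) 0" for a
  have D: "(\<Phi> a has_real_derivative D a) (at 0)" for a
    using diff[of a] unfolding D_def
    by (metis DERIV_imp_deriv real_differentiable_def)
  have uniq: "D c = d" if "(f has_real_derivative d) (at 0)" "\<forall>\<^sub>F t in nhds 0. \<Phi> c t = f t" for c d f
  proof -
    have "(\<Phi> c has_real_derivative d) (at 0)"
      using that(1) DERIV_cong_ev[OF refl that(2) refl] by simp
    then show ?thesis using D DERIV_unique by blast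
  qed
  show ?thesis
  proof
    show "derivation D" unfolding derivation_def
    proof (intro conjI allI)
      fix a b
      show "D (a + b) = D a + D b"
        by (rule uniq[OF DERIV_add[OF D D] add])
      have "((\<lambda>t. \<Phi> a t * \<Phi> b t) has_real_derivative D a * b + a * D b) (at 0)"
        using DERIV_mult[OF D D, of a b] by (simp add: val algebra_simps)
      then show "D (a * b) = D a * b + a * D b" by (rule uniq[OF _ mult])
    qed
    show "(f has_real_derivative D (f 0)) (at 0)" if "f \<in> G" for f
      using D[of "f 0"] DERIV_cong_ev[OF refl on_G[OF that] refl] by simp
  qed
qed

section \<open>Polynomials at algebraically independent points\<close>

definition eval_monom :: "('i \<Rightarrow> real) \<Rightarrow> ('i \<Rightarrow>\<^sub>0 nat) \<Rightarrow> real" where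
  "eval_monom x m = (\<Prod>i\<in>Poly_Mapping.keys m. x i ^ Poly_Mapping.lookup m i)"

lemma eval_monom_superset:
  assumes "finite S" "Poly_Mapping.keys m \<subseteq> S"
  shows "eval_monom x m = (\<Prod>i\<in>S. x i ^ Poly_Mapping.lookup m i)"
  unfolding eval_monom_def
  by (rule prod.mono_neutral_left) (use assms in \<open>auto simp: in_keys_iff\<close>)

lemma eval_monom_add: "eval_monom x (m + n) = eval_monom x m * eval_monom x n"
proof -
  let ?S = "Poly_Mapping.keys m \<union> Poly_Mapping.keys n"
  have "Poly_Mapping.keys (m + n) \<subseteq> ?S" by (rule Poly_Mapping.keys_add)
  then show ?thesis
    by (simp add: eval_monom_superset[of ?S] lookup_add power_add prod.distrib)
qed

lemma eval_rat_mpoly_superset: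
  assumes "finite S" "Poly_Mapping.keys P \<subseteq> S"
  shows "eval_rat_mpoly x P = (\<Sum>m\<in>S. of_rat (Poly_Mapping.lookup P m) * eval_monom x m)"
  unfolding eval_rat_mpoly_def eval_monom_def
  by (rule sum.mono_neutral_left) (use assms in \<open>auto simp: in_keys_iff\<close>)

lemma eval_rat_mpoly_add: "eval_rat_mpoly x (P + Q) = eval_rat_mpoly x P + eval_rat_mpoly x Q"
proof -
  let ?S = "Poly_Mapping.keys P \<union> Poly_Mapping.keys Q"
  have "Poly_Mapping.keys (P + Q) \<subseteq> ?S" by (rule Poly_Mapping.keys_add)
  then show ?thesis
    by (simp add: eval_rat_mpoly_superset[of ?S] lookup_add of_rat_add algebra_simps sum.distrib)
qed

lemma eval_rat_mpoly_0 [simp]: "eval_rat_mpoly x 0 = 0"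
  by (simp add: eval_rat_mpoly_def)

lemma eval_rat_mpoly_uminus: "eval_rat_mpoly x (- P) = - eval_rat_mpoly x P"
  using eval_rat_mpoly_add[of x P "- P"] by simp

lemma eval_rat_mpoly_sum: "eval_rat_mpoly x (\<Sum>a\<in>A. f a) = (\<Sum>a\<in>A. eval_rat_mpoly x (f a))"
  by (induction A rule: infinite_finite_induct) (auto simp: eval_rat_mpoly_add)

lemma eval_rat_mpoly_single: "eval_rat_mpoly x (Poly_Mapping.single m c) = of_rat c * eval_monom x m"
  by (simp add: eval_rat_mpoly_superset[of "{m}"])

lemma eval_monom_single: "eval_monom x (Poly_Mapping.single i e) = x i ^ e"
  by (simp add: eval_monom_superset[of "{i}"])

lemma eval_rat_mpoly_1 [simp]: "eval_rat_mpoly x 1 = 1"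
  using eval_rat_mpoly_single[of x 0 1] by (simp add: eval_monom_def)

lemma poly_mapping_eq_sum_single:
  "P = (\<Sum>m\<in>Poly_Mapping.keys P. Poly_Mapping.single m (Poly_Mapping.lookup P m))"
proof (rule poly_mapping_eqI)
  fix k
  have "(\<Sum>m\<in>Poly_Mapping.keys P. Poly_Mapping.lookup (Poly_Mapping.single m (Poly_Mapping.lookup P m)) k)
      = (\<Sum>m\<in>Poly_Mapping.keys P. if m = k then Poly_Mapping.lookup P k else 0)"
    by (intro sum.cong) (auto simp: lookup_single when_def)
  also have "\<dots> = Poly_Mapping.lookup P k" by (simp add: in_keys_iff)
  finally show "Poly_Mapping.lookup P k =
      Poly_Mapping.lookup (\<Sum>m\<in>Poly_Mapping.keys P. Poly_Mapping.single m (Poly_Mapping.lookup P m)) k"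
    by (simp add: lookup_sum)
qed

lemma eval_rat_mpoly_mult: "eval_rat_mpoly x (P * Q) = eval_rat_mpoly x P * eval_rat_mpoly x Q"
proof -
  let ?s = "\<lambda>P m. Poly_Mapping.single m (Poly_Mapping.lookup P m)"
  have "P * Q = (\<Sum>m\<in>Poly_Mapping.keys P. \<Sum>n\<in>Poly_Mapping.keys Q. ?s P m * ?s Q n)"
    by (simp only: sum_product[symmetric] poly_mapping_eq_sum_single[symmetric])
  also have "eval_rat_mpoly x \<dots> =
      (\<Sum>m\<in>Poly_Mapping.keys P. \<Sum>n\<in>Poly_Mapping.keys Q. eval_rat_mpoly x (?s P m) * eval_rat_mpoly x (?s Q n))"
    by (simp add: eval_rat_mpoly_sum mult_single eval_rat_mpoly_single eval_monom_add of_rat_mult mult.assoc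
        mult.left_commute)
  also have "\<dots> = eval_rat_mpoly x (\<Sum>m\<in>Poly_Mapping.keys P. ?s P m) * eval_rat_mpoly x (\<Sum>m\<in>Poly_Mapping.keys Q. ?s Q m)"
    by (simp add: eval_rat_mpoly_sum sum_product)
  finally show ?thesis by (simp only: poly_mapping_eq_sum_single[symmetric])
qed

text \<open>Polynomials are treated as functions, so that matrix entries can be combined by ring
  operations without naming coefficients.\<close>

definition rat_poly_fun :: "'i set \<Rightarrow> (('i \<Rightarrow> real) \<Rightarrow> real) \<Rightarrow> bool" where
  "rat_poly_fun I f \<longleftrightarrow> (\<exists>P. (\<forall>m\<in>Poly_Mapping.keys P. Poly_Mapping.keys m \<subseteq> I) \<and> f = (\<lambda>x. eval_rat_mpoly x P))"

lemma rat_poly_fun_0: "rat_poly_fun I (\<lambda>_. 0)"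
  unfolding rat_poly_fun_def by (intro exI[of _ 0]) auto

lemma rat_poly_fun_1: "rat_poly_fun I (\<lambda>_. 1)"
  unfolding rat_poly_fun_def
  by (intro exI[of _ 1]) auto

lemma rat_poly_fun_var: "i \<in> I \<Longrightarrow> rat_poly_fun I (\<lambda>x. x i)"
  unfolding rat_poly_fun_def
  by (intro exI[of _ "Poly_Mapping.single (Poly_Mapping.single i 1) 1"])
    (auto simp: eval_rat_mpoly_single eval_monom_def)

lemma rat_poly_fun_add:
  assumes "rat_poly_fun I f" "rat_poly_fun I g"
  shows "rat_poly_fun I (\<lambda>x. f x + g x)"
proof -
  obtain P Q where "\<forall>m\<in>Poly_Mapping.keys P. Poly_Mapping.keys m \<subseteq> I" "f = (\<lambda>x. eval_rat_mpoly x P)"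
    "\<forall>m\<in>Poly_Mapping.keys Q. Poly_Mapping.keys m \<subseteq> I" "g = (\<lambda>x. eval_rat_mpoly x Q)"
    using assms unfolding rat_poly_fun_def by blast
  then show ?thesis unfolding rat_poly_fun_def
    using Poly_Mapping.keys_add[of P Q] by (intro exI[of _ "P + Q"]) (auto simp: eval_rat_mpoly_add)
qed

lemma rat_poly_fun_uminus:
  assumes "rat_poly_fun I f"
  shows "rat_poly_fun I (\<lambda>x. - f x)"
proof -
  obtain P where "\<forall>m\<in>Poly_Mapping.keys P. Poly_Mapping.keys m \<subseteq> I" "f = (\<lambda>x. eval_rat_mpoly x P)"
    using assms unfolding rat_poly_fun_def by blast
  then show ?thesis unfolding rat_poly_fun_def
    by (intro exI[of _ "- P"]) (auto simp: eval_rat_mpoly_uminus in_keys_iff)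
qed

lemma rat_poly_fun_diff: "rat_poly_fun I f \<Longrightarrow> rat_poly_fun I g \<Longrightarrow> rat_poly_fun I (\<lambda>x. f x - g x)"
  using rat_poly_fun_add[OF _ rat_poly_fun_uminus, of I f g] by simp

lemma rat_poly_fun_mult:
  assumes "rat_poly_fun I f" "rat_poly_fun I g"
  shows "rat_poly_fun I (\<lambda>x. f x * g x)"
proof -
  obtain P Q where PQ: "\<forall>m\<in>Poly_Mapping.keys P. Poly_Mapping.keys m \<subseteq> I" "f = (\<lambda>x. eval_rat_mpoly x P)"
    "\<forall>m\<in>Poly_Mapping.keys Q. Poly_Mapping.keys m \<subseteq> I" "g = (\<lambda>x. eval_rat_mpoly x Q)"
    using assms unfolding rat_poly_fun_def by blast
  have "Poly_Mapping.keys m \<subseteq> I" if m: "m \<in> Poly_Mapping.keys (P * Q)" for m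
  proof -
    obtain a b where "m = a + b" "a \<in> Poly_Mapping.keys P" "b \<in> Poly_Mapping.keys Q"
      using keys_mult[of P Q] m by blast
    then show ?thesis using PQ Poly_Mapping.keys_add[of a b] by blast
  qed
  then show ?thesis unfolding rat_poly_fun_def
    using PQ by (intro exI[of _ "P * Q"]) (auto simp: eval_rat_mpoly_mult)
qed

lemma alg_indep_rat_vanish:
  assumes "alg_indep_rat I p" "rat_poly_fun I f" "f p = 0"
  shows "f x = 0"
proof -
  obtain P where P: "\<forall>m\<in>Poly_Mapping.keys P. Poly_Mapping.keys m \<subseteq> I" "f = (\<lambda>x. eval_rat_mpoly x P)"
    using assms(2) unfolding rat_poly_fun_def by blast
  then have "P = 0" using assms(1,3) unfolding alg_indep_rat_def by auto
  then show ?thesis using P by simp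
qed

lemma alg_indep_rat_mono: "alg_indep_rat I x \<Longrightarrow> J \<subseteq> I \<Longrightarrow> alg_indep_rat J x"
  unfolding alg_indep_rat_def by (meson order_trans)

text \<open>Serves to rename the vertices of a generic framework. A relation is pushed forward along
  \<open>g\<close> monomial by monomial; injectivity on \<open>J\<close> keeps distinct monomials
  distinct, so nothing cancels.\<close>

lemma alg_indep_rat_reindex:
  fixes x :: "'i \<Rightarrow> real" and g :: "'j \<Rightarrow> 'i"
  assumes x: "alg_indep_rat I x" and inj: "inj_on g J" and gJ: "g ` J \<subseteq> I"
  shows "alg_indep_rat J (\<lambda>j. x (g j))"
  unfolding alg_indep_rat_def
proof (intro allI impI, elim conjE)
  fix P :: "('j \<Rightarrow>\<^sub>0 nat) \<Rightarrow>\<^sub>0 rat"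
  assume PJ: "\<forall>m\<in>Poly_Mapping.keys P. Poly_Mapping.keys m \<subseteq> J" and P0: "eval_rat_mpoly (\<lambda>j. x (g j)) P = 0"
  define h :: "('j \<Rightarrow>\<^sub>0 nat) \<Rightarrow> ('i \<Rightarrow>\<^sub>0 nat)" where
    "h m = (\<Sum>j\<in>Poly_Mapping.keys m. Poly_Mapping.single (g j) (Poly_Mapping.lookup m j))" for m
  define Q where "Q = (\<Sum>m\<in>Poly_Mapping.keys P. Poly_Mapping.single (h m) (Poly_Mapping.lookup P m))"
  have lookup_h: "Poly_Mapping.lookup (h m) (g j) = Poly_Mapping.lookup m j"
    if "Poly_Mapping.keys m \<subseteq> J" "j \<in> J" for m j
  proof -
    have "Poly_Mapping.lookup (h m) (g j)
        = (\<Sum>k\<in>Poly_Mapping.keys m. if k = j then Poly_Mapping.lookup m j else 0)"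
      unfolding h_def lookup_sum
      by (intro sum.cong) (use that inj in \<open>auto simp: lookup_single when_def inj_on_def\<close>)
    then show ?thesis by (simp add: in_keys_iff)
  qed
  have keys_h: "Poly_Mapping.keys (h m) \<subseteq> I" if "Poly_Mapping.keys m \<subseteq> J" for m
  proof
    fix i assume "i \<in> Poly_Mapping.keys (h m)"
    then have "i \<in> (\<Union>j\<in>Poly_Mapping.keys m. Poly_Mapping.keys (Poly_Mapping.single (g j) (Poly_Mapping.lookup m j)))"
      unfolding h_def by (rule subsetD[OF Poly_Mapping.keys_sum])
    then show "i \<in> I" using that gJ by (auto split: if_splits)
  qed
  have inj_h: "inj_on h (Poly_Mapping.keys P)"
  proof (rule inj_onI)
    fix m n assume mn: "m \<in> Poly_Mapping.keys P" "n \<in> Poly_Mapping.keys P" "h m = h n"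
    show "m = n"
    proof (rule poly_mapping_eqI)
      fix j
      show "Poly_Mapping.lookup m j = Poly_Mapping.lookup n j"
      proof (cases "j \<in> J")
        case True
        then show ?thesis using lookup_h[of m j] lookup_h[of n j] mn PJ by simp
      next
        case False
        then have "j \<notin> Poly_Mapping.keys m" "j \<notin> Poly_Mapping.keys n" using mn PJ by blast+
        then show ?thesis by (simp add: in_keys_iff)
      qed
    qed
  qed
  have lookup_Q: "Poly_Mapping.lookup Q (h m) = Poly_Mapping.lookup P m" if "m \<in> Poly_Mapping.keys P" for m
  proof -
    have "Poly_Mapping.lookup Q (h m) = (\<Sum>k\<in>Poly_Mapping.keys P. if k = m then Poly_Mapping.lookup P m else 0)"
      unfolding Q_def lookup_sum
      by (intro sum.cong) (use that inj_h in \<open>auto simp: lookup_single when_def inj_on_def\<close>)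
    then show ?thesis using that by simp
  qed
  have monom_h: "eval_monom x (h m) = eval_monom (\<lambda>j. x (g j)) m" if "Poly_Mapping.keys m \<subseteq> J" for m
  proof -
    have "eval_monom x (\<Sum>j\<in>A. Poly_Mapping.single (g j) (e j)) = (\<Prod>j\<in>A. x (g j) ^ e j)" if "finite A"
      for A and e :: "'j \<Rightarrow> nat"
      using that by induction (auto simp: eval_monom_add eval_monom_single, auto simp: eval_monom_def)
    then show ?thesis unfolding h_def eval_monom_def[of _ m] by simp
  qed
  have "eval_rat_mpoly x Q = eval_rat_mpoly (\<lambda>j. x (g j)) P"
    unfolding Q_def eval_rat_mpoly_sum eval_rat_mpoly_single
    by (subst eval_rat_mpoly_superset[OF _ order_refl]) (auto simp: monom_h PJ)
  moreover have "Poly_Mapping.keys m \<subseteq> I" if "m \<in> Poly_Mapping.keys Q" for m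
  proof -
    have "m \<in> (\<Union>n\<in>Poly_Mapping.keys P. Poly_Mapping.keys (Poly_Mapping.single (h n) (Poly_Mapping.lookup P n)))"
      using that unfolding Q_def by (rule subsetD[OF Poly_Mapping.keys_sum])
    then show ?thesis using keys_h PJ by (auto split: if_splits)
  qed
  ultimately have Q0: "Q = 0" using x P0 unfolding alg_indep_rat_def by auto
  show "P = 0"
  proof (rule ccontr)
    assume "P \<noteq> 0"
    then obtain m where "m \<in> Poly_Mapping.keys P" by (metis ex_in_conv keys_eq_empty)
    then show False using lookup_Q[of m] Q0 by (simp add: in_keys_iff)
  qed
qed

lemma differentiable_eval_rat_mpoly:
  "(\<lambda>t. eval_rat_mpoly (\<lambda>i. x i + t * z i) P) differentiable (at (0::real))"
proof -
  have "(\<lambda>t. \<Prod>i\<in>S. (x i + t * z i) ^ e i) differentiable (at (0::real))" if "finite S" for S and e :: "_ \<Rightarrow> nat"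
    using that by induction (auto intro!: differentiable_mult)
  then show ?thesis
    unfolding eval_rat_mpoly_def
    by (intro differentiable_sum differentiable_mult differentiable_const ballI) auto
qed

text \<open>Polynomial functions are restricted to the line through \<open>x\<close> in direction
  \<open>z\<close>. By independence one that vanishes at \<open>x\<close> vanishes identically, so
  the restrictions form a germ ring, and its derivation differentiates along the line.\<close>

theorem alg_indep_rat_derivation:
  assumes x: "alg_indep_rat I x"
  obtains D where "derivation D" "\<And>i. i \<in> I \<Longrightarrow> D (x i) = z i"
proof -
  define G where "G = {\<lambda>t. f (\<lambda>i. x i + t * z i) | f. rat_poly_fun I f}"
  have GI: "(\<lambda>t. f (\<lambda>i. x i + t * z i)) \<in> G" if "rat_poly_fun I f" for f
    using that unfolding G_def by blast
  have "germ_ring G"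
    unfolding germ_ring_def
  proof (intro conjI ballI impI)
    fix u assume "u \<in> G"
    then obtain f where f: "u = (\<lambda>t. f (\<lambda>i. x i + t * z i))" "rat_poly_fun I f" unfolding G_def by blast
    show "u differentiable (at 0)"
      using f differentiable_eval_rat_mpoly unfolding rat_poly_fun_def by auto
    show "(\<lambda>t. - u t) \<in> G" using GI[OF rat_poly_fun_uminus[OF f(2)]] f(1) by simp
    show "\<forall>\<^sub>F t in nhds 0. u t = 0" if "u 0 = 0"
      using alg_indep_rat_vanish[OF x f(2)] that f(1) by simp
    fix v assume "v \<in> G"
    then obtain g where g: "v = (\<lambda>t. g (\<lambda>i. x i + t * z i))" "rat_poly_fun I g" unfolding G_def by blast
    show "(\<lambda>t. u t + v t) \<in> G" using GI[OF rat_poly_fun_add[OF f(2) g(2)]] f(1) g(1) by simp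
    show "(\<lambda>t. u t * v t) \<in> G" using GI[OF rat_poly_fun_mult[OF f(2) g(2)]] f(1) g(1) by simp
  qed (use GI[OF rat_poly_fun_1] in simp)
  then obtain D where D: "derivation D" "\<And>f. f \<in> G \<Longrightarrow> (f has_real_derivative D (f 0)) (at 0)"
    using germ_ring_derivation by blast
  show ?thesis
  proof (rule that[OF D(1)])
    fix i assume "i \<in> I"
    have "((\<lambda>t. x i + t * z i) has_real_derivative D (x i)) (at 0)"
      using D(2)[OF GI[OF rat_poly_fun_var[OF \<open>i \<in> I\<close>]]] by simp
    moreover have "((\<lambda>t. x i + t * z i) has_real_derivative z i) (at 0)"
      by (auto intro!: derivative_eq_intros)
    ultimately show "D (x i) = z i" by (rule DERIV_unique)
  qed
qed

lemma derivation_rules: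
  assumes "derivation D"
  shows derivation_add: "D (a + b) = D a + D b"
    and derivation_mult: "D (a * b) = D a * b + a * D b"
    and derivation_0: "D 0 = 0"
    and derivation_1: "D 1 = 0"
    and derivation_uminus: "D (- a) = - D a"
    and derivation_diff: "D (a - b) = D a - D b"
    and derivation_power2: "D (a\<^sup>2) = 2 * a * D a"
proof -
  have add: "D (a + b) = D a + D b" and mult: "D (a * b) = D a * b + a * D b" for a b
    using assms unfolding derivation_def by blast+
  show "D (a + b) = D a + D b" "D (a * b) = D a * b + a * D b" by (fact add mult)+
  show "D 0 = 0" using add[of 0 0] by simp
  then show "D (- a) = - D a" using add[of a "- a"] by simp
  then show "D (a - b) = D a - D b" using add[of a "- b"] add[of b "- b"] \<open>D 0 = 0\<close> by simp
  show "D 1 = 0" using mult[of 1 1] by simp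
  show "D (a\<^sup>2) = 2 * a * D a" using mult[of a a] by (simp add: power2_eq_square)
qed

lemma derivation_sum:
  assumes "derivation D"
  shows "D (\<Sum>i\<in>A. f i) = (\<Sum>i\<in>A. D (f i))"
  by (induction A rule: infinite_finite_induct) (auto simp: derivation_rules[OF assms])

lemma derivation_poly:
  assumes D: "derivation D" and c: "\<And>i. D (coeff g i) = 0"
  shows "D (poly g y) = poly (pderiv g) y * D y"
  using c
proof (induction g)
  case (pCons a g)
  have "D (coeff g i) = 0" for i using pCons.prems[of "Suc i"] by simp
  then have "D (poly g y) = poly (pderiv g) y * D y" by (rule pCons.IH)
  moreover have "D a = 0" using pCons.prems[of 0] by simp
  ultimately show ?case by (simp add: derivation_rules[OF D] pderiv_pCons algebra_simps)
qed (simp add: derivation_rules[OF D])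

text \<open>Applying \<open>D\<close> to the relation leaves
  \<open>poly (pderiv g) y * D y = 0\<close>, a relation of smaller degree whose coefficients are
  again killed by \<open>D\<close>.\<close>

lemma derivation_transcendental:
  assumes D: "derivation D" and y: "D y \<noteq> 0" and c: "\<And>i. D (coeff g i) = 0" and root: "poly g y = 0"
  shows "g = 0"
  using c root
proof (induction "degree g" arbitrary: g rule: less_induct)
  case less
  show ?case
  proof (cases "degree g = 0")
    case True
    then obtain a where "g = [:a:]" by (rule degree_eq_zeroE)
    then show ?thesis using less.prems by simp
  next
    case False
    have "poly (pderiv g) y = 0"
      using derivation_poly[OF D less.prems(1), of y] less.prems(2) y by (simp add: derivation_rules[OF D])
    moreover have "D (of_nat n) = 0" for n
      by (induction n) (auto simp: derivation_rules[OF D])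
    then have "D (coeff (pderiv g) i) = 0" for i
      unfolding coeff_pderiv by (simp add: derivation_rules[OF D] less.prems del: of_nat_Suc)
    ultimately have "pderiv g = 0" using less.hyps[of "pderiv g"] False by (simp add: degree_pderiv)
    then show ?thesis using False by (simp add: pderiv_eq_0_iff)
  qed
qed

text \<open>As \<open>y\<close> is transcendental over the constants of \<open>D\<close>, the
  polynomials in \<open>y + t\<close> over these constants form a germ ring. Its section fixes the
  constants and moves \<open>y\<close> at unit speed.\<close>

lemma derivation_germ_section:
  assumes D: "derivation D" and y: "D y \<noteq> 0"
  obtains \<Phi> where "\<And>a. \<Phi> a differentiable (at 0)" "\<And>a. \<Phi> a 0 = a"
    "\<And>a b. \<forall>\<^sub>F t in nhds 0. \<Phi> (a + b) t = \<Phi> a t + \<Phi> b t"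
    "\<And>a b. \<forall>\<^sub>F t in nhds 0. \<Phi> (a * b) t = \<Phi> a t * \<Phi> b t"
    "\<And>a. D a = 0 \<Longrightarrow> \<forall>\<^sub>F t in nhds 0. \<Phi> a t = a"
    "\<forall>\<^sub>F t in nhds 0. \<Phi> y t = y + t"
proof -
  note Drules = derivation_rules[OF D]
  define G where "G = {\<lambda>t. poly g (y + t) | g. \<forall>i. D (coeff g i) = 0}"
  have GI: "(\<lambda>t. poly g (y + t)) \<in> G" if "\<And>i. D (coeff g i) = 0" for g
    using that unfolding G_def by blast
  have "germ_ring G"
    unfolding germ_ring_def
  proof (intro conjI ballI impI)
    show "(\<lambda>_. 1) \<in> G" using GI[of 1] by (simp add: Drules)
    fix u assume "u \<in> G"
    then obtain f where f: "u = (\<lambda>t. poly f (y + t))" "\<And>i. D (coeff f i) = 0" unfolding G_def by blast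
    show "u differentiable (at 0)"
      unfolding f(1) poly_altdef
      by (intro differentiable_sum differentiable_mult differentiable_power differentiable_add
          differentiable_const differentiable_ident ballI finite_atMost)
    show "(\<lambda>t. - u t) \<in> G" using GI[of "- f"] f by (simp add: Drules)
    show "\<forall>\<^sub>F t in nhds 0. u t = 0" if "u 0 = 0"
      using derivation_transcendental[OF D y f(2)] that f(1) by simp
    fix v assume "v \<in> G"
    then obtain g where g: "v = (\<lambda>t. poly g (y + t))" "\<And>i. D (coeff g i) = 0" unfolding G_def by blast
    show "(\<lambda>t. u t + v t) \<in> G" using GI[of "f + g"] f g by (simp add: Drules)
    show "(\<lambda>t. u t * v t) \<in> G"
      using GI[of "f * g"] f g by (simp add: Drules derivation_sum[OF D] coeff_mult)
  qed
  then obtain \<Phi> where Phi: "\<And>a. \<Phi> a differentiable (at 0)" "\<And>a. \<Phi> a 0 = a"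
    "\<And>a b. \<forall>\<^sub>F t in nhds 0. \<Phi> (a + b) t = \<Phi> a t + \<Phi> b t"
    "\<And>a b. \<forall>\<^sub>F t in nhds 0. \<Phi> (a * b) t = \<Phi> a t * \<Phi> b t"
    "\<And>f. f \<in> G \<Longrightarrow> \<forall>\<^sub>F t in nhds 0. \<Phi> (f 0) t = f t"
    using germ_section by blast
  show ?thesis
  proof (rule that[OF Phi(1-4)])
    show "\<forall>\<^sub>F t in nhds 0. \<Phi> a t = a" if "D a = 0" for a
      using Phi(5)[OF GI[of "[:a:]"]] that by (auto simp: coeff_pCons Drules split: nat.split)
    show "\<forall>\<^sub>F t in nhds 0. \<Phi> y t = y + t"
      using Phi(5)[OF GI[of "[:0, 1:]"]] by (auto simp: coeff_pCons Drules split: nat.split)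
  qed
qed

text \<open>Linear independence, witnessed by a dual system \<open>z\<close>. Explicit dual vectors
  are used because derivations supply them: their values on the coordinates of a framework are such
  vectors.\<close>

definition free_rows :: "('b \<Rightarrow> 'j \<Rightarrow> real) \<Rightarrow> 'j set \<Rightarrow> 'b set \<Rightarrow> bool" where
  "free_rows a J B \<longleftrightarrow> (\<exists>z. \<forall>b\<in>B. \<forall>c\<in>B. (\<Sum>j\<in>J. a c j * z b j) = (if b = c then 1 else 0))"

text \<open>Among the rows only \<open>e\<close> sees \<open>z\<close>. Scaled, \<open>z\<close> is
  dual to \<open>e\<close>; subtracting multiples of it makes the old dual vectors vanish on
  \<open>e\<close>.\<close>

lemma free_rows_insert:
  assumes free: "free_rows a J B" and z: "\<And>b. b \<in> B \<Longrightarrow> (\<Sum>j\<in>J. a b j * z j) = 0"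
    and e: "(\<Sum>j\<in>J. a e j * z j) \<noteq> 0"
  shows "free_rows a J (insert e B)"
proof -
  have eB: "e \<notin> B" using z e by blast
  obtain w where w: "\<And>b c. b \<in> B \<Longrightarrow> c \<in> B \<Longrightarrow> (\<Sum>j\<in>J. a c j * w b j) = (if b = c then 1 else 0)"
    using free unfolding free_rows_def by blast
  define s where "s = (\<Sum>j\<in>J. a e j * z j)"
  define v where "v b j = (if b = e then z j / s else w b j - (\<Sum>k\<in>J. a e k * w b k) * (z j / s))" for b j
  have zs: "(\<Sum>j\<in>J. a c j * (z j / s)) = (if c = e then 1 else 0)" if "c \<in> insert e B" for c
  proof -
    have "(\<Sum>j\<in>J. a c j * (z j / s)) = (\<Sum>j\<in>J. a c j * z j) / s" by (simp add: sum_divide_distrib)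
    then show ?thesis using that z e unfolding s_def by auto
  qed
  have v: "(\<Sum>j\<in>J. a c j * v b j) = (\<Sum>j\<in>J. a c j * w b j) - (\<Sum>k\<in>J. a e k * w b k) * (\<Sum>j\<in>J. a c j * (z j / s))"
    if "b \<noteq> e" for b c
    using that unfolding v_def
    by (simp add: right_diff_distrib sum_subtractf sum_distrib_left mult.left_commute)
  have "(\<Sum>j\<in>J. a c j * v b j) = (if b = c then 1 else 0)" if "b \<in> insert e B" "c \<in> insert e B" for b c
  proof (cases "b = e")
    case True
    then show ?thesis using zs[OF that(2)] unfolding v_def by auto
  next
    case False
    then show ?thesis using v[OF False, of c] zs[OF that(2)] w that eB by auto
  qed
  then show ?thesis unfolding free_rows_def by blast
qed

text \<open>A maximal free subset spans, in dual form: a vector annihilated by it but not by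
  \<open>e\<close> would let \<open>e\<close> be added.\<close>

lemma free_rows_basis:
  assumes "finite E"
  obtains B where "B \<subseteq> E" "free_rows a J B"
    "\<And>z e. \<lbrakk>\<And>b. b \<in> B \<Longrightarrow> (\<Sum>j\<in>J. a b j * z j) = 0; e \<in> E\<rbrakk> \<Longrightarrow> (\<Sum>j\<in>J. a e j * z j) = 0"
proof -
  define \<B> where "\<B> = {B. B \<subseteq> E \<and> free_rows a J B}"
  have "finite \<B>" using assms unfolding \<B>_def by simp
  moreover have "{} \<in> \<B>" unfolding \<B>_def free_rows_def by simp
  ultimately obtain B where B: "B \<in> \<B>" and max: "\<And>C. C \<in> \<B> \<Longrightarrow> B \<subseteq> C \<Longrightarrow> B = C"
    using finite_has_maximal[of \<B>] by blast
  show ?thesis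
  proof (rule that)
    show "B \<subseteq> E" "free_rows a J B" using B unfolding \<B>_def by auto
    fix z e assume z: "\<And>b. b \<in> B \<Longrightarrow> (\<Sum>j\<in>J. a b j * z j) = 0" and e: "e \<in> E"
    show "(\<Sum>j\<in>J. a e j * z j) = 0"
    proof (rule ccontr)
      assume ne: "\<not> ?thesis"
      then have "insert e B \<in> \<B>"
        using free_rows_insert[of a J B z e] B z e unfolding \<B>_def by blast
      then have "e \<in> B" using max[of "insert e B"] by blast
      with z ne show False by blast
    qed
  qed
qed

text \<open>One step of fraction-free Gaussian elimination reduces the number of rows; the pivot is chosen
  nonzero at \<open>q\<close>, hence is nonzero at \<open>p\<close>.\<close>

lemma free_rows_generic:
  fixes M :: "'b \<Rightarrow> 'j \<Rightarrow> ('i \<Rightarrow> real) \<Rightarrow> real"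
  assumes p: "alg_indep_rat I p" and "finite J" and "finite B"
    and "\<And>b j. b \<in> B \<Longrightarrow> j \<in> J \<Longrightarrow> rat_poly_fun I (M b j)"
    and "free_rows (\<lambda>b j. M b j q) J B"
  shows "free_rows (\<lambda>b j. M b j p) J B"
  using assms(3-)
proof (induction B arbitrary: M rule: finite_induct)
  case empty
  show ?case unfolding free_rows_def by simp
next
  case (insert b B)
  obtain z where z: "\<And>a c. a \<in> insert b B \<Longrightarrow> c \<in> insert b B \<Longrightarrow>
      (\<Sum>j\<in>J. M c j q * z a j) = (if a = c then 1 else 0)"
    using insert.prems(2) unfolding free_rows_def by blast
  have "(\<Sum>j\<in>J. M b j q * z b j) \<noteq> 0" using z[of b b] by simp
  then have "\<exists>j\<in>J. M b j q * z b j \<noteq> 0" by (rule contrapos_np) (auto intro: sum.neutral)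
  then obtain k where k: "k \<in> J" "M b k q \<noteq> 0" by auto
  then have piv: "M b k p \<noteq> 0"
    using alg_indep_rat_vanish[OF p insert.prems(1)[of b k], of q] by auto
  define N where "N c j x = M b k x * M c j x - M c k x * M b j x" for c j x
  have N_sum: "(\<Sum>j\<in>J. N c j x * w j) = M b k x * (\<Sum>j\<in>J. M c j x * w j) - M c k x * (\<Sum>j\<in>J. M b j x * w j)"
    for c x w
    unfolding N_def by (simp add: left_diff_distrib sum_subtractf sum_distrib_left mult.assoc)
  have "rat_poly_fun I (N c j)" if "c \<in> B" "j \<in> J" for c j
    unfolding N_def using that k
    by (intro rat_poly_fun_diff rat_poly_fun_mult insert.prems(1)) auto
  moreover have "free_rows (\<lambda>c j. N c j q) J B"
    unfolding free_rows_def
  proof (intro exI ballI)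
    fix a c assume ac: "a \<in> B" "c \<in> B"
    have "(\<Sum>j\<in>J. M b j q * z a j) = 0" "(\<Sum>j\<in>J. M c j q * z a j) = (if a = c then 1 else 0)"
      using z[of a b] z[of a c] ac insert.hyps by auto
    moreover have "(\<Sum>j\<in>J. N c j q * (z a j / M b k q)) = (\<Sum>j\<in>J. N c j q * z a j) / M b k q"
      by (simp add: sum_divide_distrib)
    ultimately show "(\<Sum>j\<in>J. N c j q * (z a j / M b k q)) = (if a = c then 1 else 0)"
      unfolding N_sum using k by simp
  qed
  ultimately have "free_rows (\<lambda>c j. N c j p) J B" by (rule insert.IH)
  then obtain w where w: "\<And>a c. a \<in> B \<Longrightarrow> c \<in> B \<Longrightarrow> (\<Sum>j\<in>J. N c j p * w a j) = (if a = c then 1 else 0)"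
    unfolding free_rows_def by blast
  \<comment> \<open>Dual vectors of the reduced rows, scaled by the pivot and corrected in
    coordinate \<open>k\<close> so that the pivot row annihilates them.\<close>
  define u where "u a j = M b k p * w a j - (if j = k then \<Sum>i\<in>J. M b i p * w a i else 0)" for a j
  have ek: "(\<Sum>j\<in>J. M c j p * (if j = k then s else 0)) = M c k p * s" for c s
    using k(1) \<open>finite J\<close> by (simp add: if_distrib cong: if_cong)
  have u: "(\<Sum>j\<in>J. M c j p * u a j) = (\<Sum>j\<in>J. N c j p * w a j)" for a c
  proof -
    have "(\<Sum>j\<in>J. M c j p * u a j) = M b k p * (\<Sum>j\<in>J. M c j p * w a j) - M c k p * (\<Sum>i\<in>J. M b i p * w a i)"
      unfolding u_def right_diff_distrib sum_subtractf ek by (simp add: sum_distrib_left mult.left_commute)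
    then show ?thesis unfolding N_sum .
  qed
  have ub: "(\<Sum>j\<in>J. M b j p * u a j) = 0" for a
    unfolding u N_sum by simp
  have "free_rows (\<lambda>c j. M c j p) J B"
    unfolding free_rows_def using w u by (intro exI[of _ u]) auto
  \<comment> \<open>The unit vector at \<open>k\<close>, corrected so that all rows of
    \<open>B\<close> annihilate it; the pivot row takes the value \<open>M b k p\<close> on
    it.\<close>
  define v where "v j = (if j = k then 1 else 0) - (\<Sum>a\<in>B. M a k p * u a j)" for j
  have v: "(\<Sum>j\<in>J. M c j p * v j) = M c k p - (\<Sum>a\<in>B. M a k p * (\<Sum>j\<in>J. M c j p * u a j))" for c
  proof -
    have "(\<Sum>j\<in>J. M c j p * (\<Sum>a\<in>B. M a k p * u a j)) = (\<Sum>a\<in>B. M a k p * (\<Sum>j\<in>J. M c j p * u a j))"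
      unfolding sum_distrib_left by (subst sum.swap) (simp add: mult.left_commute)
    then show ?thesis unfolding v_def right_diff_distrib sum_subtractf ek by simp
  qed
  show ?case
  proof (rule free_rows_insert[of _ _ _ v])
    show "free_rows (\<lambda>c j. M c j p) J B" by fact
    show "(\<Sum>j\<in>J. M c j p * v j) = 0" if "c \<in> B" for c
    proof -
      have "(\<Sum>a\<in>B. M a k p * (\<Sum>j\<in>J. M c j p * u a j)) = (\<Sum>a\<in>B. if a = c then M c k p else 0)"
        by (intro sum.cong) (use w u that in auto)
      then show ?thesis using v[of c] that insert.hyps by simp
    qed
    show "(\<Sum>j\<in>J. M b j p * v j) \<noteq> 0" using v[of b] ub piv by simp
  qed
qed

section \<open>Rigidity\<close>

definition dot :: "nat \<Rightarrow> (nat \<Rightarrow> real) \<Rightarrow> (nat \<Rightarrow> real) \<Rightarrow> real" where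
  "dot d x y = (\<Sum>k<d. x k * y k)"

definition sq_dist :: "nat \<Rightarrow> (nat \<Rightarrow> real) \<Rightarrow> (nat \<Rightarrow> real) \<Rightarrow> real" where
  "sq_dist d x y = (\<Sum>k<d. (x k - y k)\<^sup>2)"

lemma dot_commute: "dot d x y = dot d y x"
  unfolding dot_def by (simp add: mult.commute)

lemma dot_diff_left: "dot d (\<lambda>k. x k - y k) z = dot d x z - dot d y z"
  unfolding dot_def by (simp add: left_diff_distrib sum_subtractf)

lemma dot_diff_right: "dot d z (\<lambda>k. x k - y k) = dot d z x - dot d z y"
  unfolding dot_def by (simp add: right_diff_distrib sum_subtractf)

lemma dot_scale_left: "dot d (\<lambda>k. c * x k) y = c * dot d x y"
  unfolding dot_def by (simp add: sum_distrib_left mult.assoc)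

lemma dot_scale_right: "dot d y (\<lambda>k. c * x k) = c * dot d y x"
  unfolding dot_def by (simp add: sum_distrib_left mult.left_commute)

lemma dot_sum_left: "dot d (\<lambda>k. \<Sum>i\<in>A. l i * f i k) y = (\<Sum>i\<in>A. l i * dot d (f i) y)"
  unfolding dot_def sum_distrib_right sum_distrib_left by (subst sum.swap) (simp add: mult.assoc)

lemma dot_sum_right: "dot d y (\<lambda>k. \<Sum>i\<in>A. l i * f i k) = (\<Sum>i\<in>A. l i * dot d y (f i))"
  using dot_sum_left[of d l f A y] by (simp add: dot_commute)

lemma dot_cong: "(\<And>k. k < d \<Longrightarrow> x k = x' k) \<Longrightarrow> (\<And>k. k < d \<Longrightarrow> y k = y' k) \<Longrightarrow> dot d x y = dot d x' y'"
  unfolding dot_def by (intro sum.cong) auto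

lemma dot_nonneg: "0 \<le> dot d x x"
  unfolding dot_def by (intro sum_nonneg) auto

lemma dot_self_eq_0_iff: "dot d x x = 0 \<longleftrightarrow> (\<forall>k<d. x k = 0)"
  unfolding dot_def by (subst sum_nonneg_eq_0_iff) auto

lemma sq_dist_eq_dot: "sq_dist d x y = dot d (\<lambda>k. x k - y k) (\<lambda>k. x k - y k)"
  unfolding sq_dist_def dot_def by (simp add: power2_eq_square)

lemma sq_dist_polar:
  "sq_dist d x y = dot d (\<lambda>k. x k - o' k) (\<lambda>k. x k - o' k)
     - 2 * dot d (\<lambda>k. x k - o' k) (\<lambda>k. y k - o' k) + dot d (\<lambda>k. y k - o' k) (\<lambda>k. y k - o' k)"
  unfolding sq_dist_eq_dot dot_diff_left dot_diff_right by (simp add: dot_commute algebra_simps)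

lemma sq_dist_commute: "sq_dist d x y = sq_dist d y x"
  unfolding sq_dist_def by (simp add: power2_commute)

lemma sq_dist_self [simp]: "sq_dist d x x = 0"
  unfolding sq_dist_def by simp

lemma dist_d_eq_iff: "dist_d d x y = dist_d d x' y' \<longleftrightarrow> sq_dist d x y = sq_dist d x' y'"
  unfolding dist_d_def L2_set_def sq_dist_def by simp

text \<open>Column elimination: either column \<open>k\<close> vanishes on all rows and is dropped,
  or a pivot row \<open>e\<close> clears it and is then discarded.\<close>

lemma free_rows_card_le:
  assumes "finite J" "finite B" "free_rows a J B"
  shows "card B \<le> card J"
  using assms
proof (induction J arbitrary: a B rule: finite_induct)
  case empty
  have "b \<notin> B" for b
  proof
    assume "b \<in> B"
    with empty have "(if b = b then 1 else 0) = (0::real)" unfolding free_rows_def by fastforce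
    then show False by simp
  qed
  then have "B = {}" by blast
  then show ?case by simp
next
  case (insert k J)
  obtain z where z: "\<And>b c. b \<in> B \<Longrightarrow> c \<in> B \<Longrightarrow> (\<Sum>j\<in>insert k J. a c j * z b j) = (if b = c then 1 else 0)"
    using insert.prems(2) unfolding free_rows_def by blast
  show ?case
  proof (cases "\<exists>b\<in>B. a b k \<noteq> 0")
    case False
    have "free_rows a J B"
      unfolding free_rows_def
    proof (intro exI ballI)
      fix b c assume "b \<in> B" "c \<in> B"
      then show "(\<Sum>j\<in>J. a c j * z b j) = (if b = c then 1 else 0)"
        using z[of b c] False insert.hyps by simp
    qed
    then have "card B \<le> card J" using insert.IH insert.prems(1) by blast
    then show ?thesis using insert.hyps by simp
  next
    case True
    then obtain e where e: "e \<in> B" "a e k \<noteq> 0" by blast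
    define a' where "a' c j = a c j - a c k / a e k * a e j" for c j
    have "free_rows a' J (B - {e})"
      unfolding free_rows_def
    proof (intro exI ballI)
      fix b c assume bc: "b \<in> B - {e}" "c \<in> B - {e}"
      have "a' c k = 0" unfolding a'_def using e by simp
      then have "(\<Sum>j\<in>J. a' c j * z b j) = (\<Sum>j\<in>insert k J. a' c j * z b j)" using insert.hyps by simp
      also have "\<dots> = (\<Sum>j\<in>insert k J. a c j * z b j) - a c k / a e k * (\<Sum>j\<in>insert k J. a e j * z b j)"
        unfolding a'_def left_diff_distrib sum_subtractf sum_distrib_left by (simp only: mult.assoc)
      also have "\<dots> = (if b = c then 1 else 0)" using z[of b c] z[of b e] bc e by auto
      finally show "(\<Sum>j\<in>J. a' c j * z b j) = (if b = c then 1 else 0)" .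
    qed
    then have "card (B - {e}) \<le> card J" using insert.IH[of "B - {e}" a'] insert.prems(1) by simp
    then have "card B - 1 \<le> card J" using e insert.prems(1) by simp
    then show ?thesis using insert.hyps by simp
  qed
qed

text \<open>A nonzero entry of \<open>BA - 1\<close> in row \<open>i\<close> gives a vector
  \<open>z\<close> that all rows of \<open>A\<close> annihilate but the unit row at \<open>i\<close>
  does not. That unit row, placed at index \<open>n\<close>, would make \<open>n + 1\<close>
  independent rows in dimension \<open>n\<close>.\<close>

lemma square_matrix_inverse_commute:
  fixes A B :: "nat \<Rightarrow> nat \<Rightarrow> real"
  assumes AB: "\<And>i j. i < n \<Longrightarrow> j < n \<Longrightarrow> (\<Sum>k<n. A i k * B k j) = (if i = j then 1 else 0)"
    and ij: "i < n" "j < n"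
  shows "(\<Sum>k<n. B i k * A k j) = (if i = j then 1 else 0)"
proof (rule ccontr)
  assume ne: "\<not> ?thesis"
  define z where "z l = (\<Sum>k<n. B l k * A k j) - (if l = j then 1 else 0)" for l
  have Az: "(\<Sum>l<n. A m l * z l) = 0" if "m < n" for m
  proof -
    have "(\<Sum>l<n. A m l * (\<Sum>k<n. B l k * A k j)) = (\<Sum>k<n. (\<Sum>l<n. A m l * B l k) * A k j)"
      unfolding sum_distrib_left sum_distrib_right by (subst sum.swap) (simp add: mult.assoc)
    also have "\<dots> = (\<Sum>k<n. if m = k then A k j else 0)"
      by (intro sum.cong) (use AB[OF that] in auto)
    finally have "(\<Sum>l<n. A m l * (\<Sum>k<n. B l k * A k j)) = A m j" using that by simp
    moreover have "(\<Sum>l<n. A m l * (if l = j then 1 else 0)) = A m j"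
      using ij by (simp add: if_distrib cong: if_cong)
    ultimately show ?thesis unfolding z_def right_diff_distrib sum_subtractf by simp
  qed
  define a where "a m l = (if m < n then A m l else if l = i then 1 else 0)" for m l
  have "free_rows a {..<n} (insert n {..<n})"
  proof (rule free_rows_insert[of _ _ _ z])
    show "free_rows a {..<n} {..<n}"
      unfolding free_rows_def a_def by (intro exI[of _ "\<lambda>b k. B k b"]) (use AB in auto)
    show "(\<Sum>l<n. a m l * z l) = 0" if "m \<in> {..<n}" for m
      using Az that unfolding a_def by simp
    have "(\<Sum>l<n. a n l * z l) = (\<Sum>l<n. if l = i then z i else 0)"
      unfolding a_def by (intro sum.cong) auto
    then show "(\<Sum>l<n. a n l * z l) \<noteq> 0" using ne ij unfolding z_def by simp
  qed
  from free_rows_card_le[OF _ _ this] show False by simp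
qed

section \<open>Derivations of squared distances in rigid frameworks\<close>

lemma derivation_dot:
  assumes "derivation D"
  shows "D (dot d x y) = dot d (\<lambda>k. D (x k)) y + dot d x (\<lambda>k. D (y k))"
  unfolding dot_def by (simp add: derivation_sum[OF assms] derivation_rules[OF assms] sum.distrib)

lemma derivation_dot_self:
  assumes "derivation D"
  shows "D (dot d x x) = 2 * dot d x (\<lambda>k. D (x k))"
  using derivation_dot[OF assms, of d x x] by (simp add: dot_commute)

lemma derivation_sq_dist:
  assumes "derivation D"
  shows "D (sq_dist d x y) = 2 * dot d (\<lambda>k. x k - y k) (\<lambda>k. D (x k) - D (y k))"
  unfolding sq_dist_eq_dot derivation_dot_self[OF assms] by (simp add: derivation_rules[OF assms])

text \<open>A pair distance moved by \<open>D\<close> is transcendental over the constants of \<open>D\<close>; moving it along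
  the germs of \<open>derivation_germ_section\<close> produces arbitrarily close equivalent frameworks.\<close>

lemma rigid_framework_derivation:
  assumes "finite V" and edges: "\<And>u v. {u, v} \<in> E \<Longrightarrow> u \<in> V \<and> v \<in> V"
    and rigid: "rigid_framework d V E p" and D: "derivation D"
    and kill: "\<And>u v. {u, v} \<in> E \<Longrightarrow> D (sq_dist d (p u) (p v)) = 0"
    and ab: "a \<in> V" "b \<in> V"
  shows "D (sq_dist d (p a) (p b)) = 0"
proof (rule ccontr)
  assume ne: "\<not> ?thesis"
  obtain \<Phi> where diff: "\<And>a. \<Phi> a differentiable (at 0)" and val: "\<And>a. \<Phi> a 0 = a"
    and add: "\<And>a b. \<forall>\<^sub>F t in nhds 0. \<Phi> (a + b) t = \<Phi> a t + \<Phi> b t"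
    and mult: "\<And>a b. \<forall>\<^sub>F t in nhds 0. \<Phi> (a * b) t = \<Phi> a t * \<Phi> b t"
    and const: "\<And>a. D a = 0 \<Longrightarrow> \<forall>\<^sub>F t in nhds 0. \<Phi> a t = a"
    and move: "\<forall>\<^sub>F t in nhds 0. \<Phi> (sq_dist d (p a) (p b)) t = sq_dist d (p a) (p b) + t"
    using derivation_germ_section[OF D ne] by blast
  have sub: "\<forall>\<^sub>F t in nhds 0. \<Phi> (x - y) t = \<Phi> x t - \<Phi> y t" for x y
    using add[of "x - y" y] by eventually_elim simp
  have zero: "\<forall>\<^sub>F t in nhds 0. \<Phi> 0 t = 0" by (rule const) (rule derivation_0[OF D])
  have sum: "\<forall>\<^sub>F t in nhds 0. \<Phi> (\<Sum>i\<in>A. f i) t = (\<Sum>i\<in>A. \<Phi> (f i) t)" if "finite A" for A and f :: "nat \<Rightarrow> real"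
    using that
  proof induction
    case (insert i A)
    have "\<forall>\<^sub>F t in nhds 0. \<Phi> (f i + (\<Sum>i\<in>A. f i)) t = \<Phi> (f i) t + \<Phi> (\<Sum>i\<in>A. f i) t" by (rule add)
    with insert.IH show ?case by eventually_elim (simp add: insert.hyps)
  qed (simp add: zero)
  define P where "P t v i = \<Phi> (p v i) t" for t v i
  have dist: "\<forall>\<^sub>F t in nhds 0. \<Phi> (sq_dist d (p u) (p v)) t = sq_dist d (P t u) (P t v)" for u v
  proof -
    have "\<forall>\<^sub>F t in nhds 0. \<Phi> ((p u i - p v i)\<^sup>2) t = (P t u i - P t v i)\<^sup>2" for i
      using sub[of "p u i" "p v i"] mult[of "p u i - p v i" "p u i - p v i"]
      by eventually_elim (simp add: P_def power2_eq_square)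
    then have "\<forall>\<^sub>F t in nhds 0. \<forall>i\<in>{..<d}. \<Phi> ((p u i - p v i)\<^sup>2) t = (P t u i - P t v i)\<^sup>2"
      by (intro eventually_ball_finite) auto
    with sum[OF finite_lessThan[of d], of "\<lambda>i. (p u i - p v i)\<^sup>2"] show ?thesis
      by eventually_elim (simp add: sq_dist_def)
  qed
  obtain \<epsilon> where "\<epsilon> > 0" and eps: "\<And>q. \<lbrakk>equivalent_frameworks d E p q; \<forall>v\<in>V. dist_d d (p v) (q v) < \<epsilon>\<rbrakk>
      \<Longrightarrow> congruent_frameworks d V p q"
    using rigid unfolding rigid_framework_def by blast
  have near: "\<forall>\<^sub>F t in nhds 0. \<forall>v\<in>V. dist_d d (p v) (P t v) < \<epsilon>"
  proof (intro eventually_ball_finite ballI)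
    fix v
    have cont: "((\<lambda>t. P t v i) \<longlongrightarrow> p v i) (nhds 0)" for i
      using tendsto_at_imp_nhds[OF differentiable_imp_continuous_within[OF diff[of "p v i"]]]
      unfolding P_def val .
    have "((\<lambda>t. dist_d d (p v) (P t v)) \<longlongrightarrow> dist_d d (p v) (p v)) (nhds 0)"
      unfolding dist_d_def L2_set_def by (intro tendsto_intros cont)
    then show "\<forall>\<^sub>F t in nhds 0. dist_d d (p v) (P t v) < \<epsilon>"
      by (rule order_tendstoD) (use \<open>\<epsilon> > 0\<close> in \<open>simp add: dist_d_def L2_set_def\<close>)
  qed fact
  have equiv: "\<forall>\<^sub>F t in nhds 0. \<forall>e\<in>{(u, v)\<in>V \<times> V. {u, v} \<in> E}.
      sq_dist d (P t (fst e)) (P t (snd e)) = sq_dist d (p (fst e)) (p (snd e))"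
  proof (intro eventually_ball_finite ballI)
    fix e assume "e \<in> {(u, v)\<in>V \<times> V. {u, v} \<in> E}"
    then have "D (sq_dist d (p (fst e)) (p (snd e))) = 0" using kill by auto
    from const[OF this] dist[of "fst e" "snd e"]
    show "\<forall>\<^sub>F t in nhds 0. sq_dist d (P t (fst e)) (P t (snd e)) = sq_dist d (p (fst e)) (p (snd e))"
      by eventually_elim simp
  qed (use \<open>finite V\<close> in \<open>auto intro: finite_subset[of _ "V \<times> V"]\<close>)
  \<comment> \<open>Finitely many conditions hold together near \<open>0\<close>. There rigidity
    fixes the squared distance of \<open>a\<close> and \<open>b\<close>, which changes by exactly
    \<open>t\<close>.\<close>
  have "\<forall>\<^sub>F t in nhds (0::real). t = 0"
    using near equiv move dist[of a b]
  proof eventually_elim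
    case (elim t)
    have "equivalent_frameworks d E p (P t)"
      unfolding equivalent_frameworks_def dist_d_eq_iff using elim(2) edges by auto
    then have "congruent_frameworks d V p (P t)" using eps elim(1) by blast
    then have "sq_dist d (P t a) (P t b) = sq_dist d (p a) (p b)"
      using ab unfolding congruent_frameworks_def dist_d_eq_iff by blast
    then show ?case using elim(3,4) by simp
  qed
  then have "\<forall>\<^sub>F t in at (0::real). False"
    unfolding eventually_at_filter by eventually_elim simp
  then show False by simp
qed

text \<open>The rigidity matrix row of an ordered pair \<open>e\<close>, half the gradient of its
  squared distance. It depends on \<open>x\<close> so that the same polynomial matrix can be
  evaluated at both frameworks.\<close>

definition rigidity_row :: "'v \<times> 'v \<Rightarrow> 'v \<times> nat \<Rightarrow> ('v \<times> nat \<Rightarrow> real) \<Rightarrow> real" where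
  "rigidity_row e j x = ((if fst j = fst e then 1 else 0) - (if fst j = snd e then 1 else 0)) *
     (x (fst e, snd j) - x (snd e, snd j))"

lemma rigidity_row_sum:
  assumes "finite V" "u \<in> V" "v \<in> V"
  shows "(\<Sum>j\<in>V \<times> {..<d}. rigidity_row (u, v) j x * z j) =
    dot d (\<lambda>k. x (u, k) - x (v, k)) (\<lambda>k. z (u, k) - z (v, k))"
proof -
  have "(\<Sum>j\<in>V \<times> {..<d}. rigidity_row (u, v) j x * z j) =
      (\<Sum>k<d. \<Sum>w\<in>V. ((if w = u then x (u, k) - x (v, k) else 0) - (if w = v then x (u, k) - x (v, k) else 0)) * z (w, k))"
    unfolding sum.cartesian_product' rigidity_row_def
    by (subst sum.swap) (auto intro!: sum.cong)
  also have "\<dots> = (\<Sum>k<d. (x (u, k) - x (v, k)) * z (u, k) - (x (u, k) - x (v, k)) * z (v, k))"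
    using assms
    by (intro sum.cong) (simp_all add: left_diff_distrib sum_subtractf if_distrib[of "\<lambda>c. c * _"] cong: if_cong)
  finally show ?thesis unfolding dot_def by (simp add: right_diff_distrib)
qed

lemma rat_poly_fun_rigidity_row:
  assumes "fst e \<in> V" "snd e \<in> V" "j \<in> V \<times> {..<d}"
  shows "rat_poly_fun (V \<times> {..<d}) (rigidity_row e j)"
proof -
  have lin: "rat_poly_fun (V \<times> {..<d}) (\<lambda>x. x (fst e, snd j) - x (snd e, snd j))"
    using assms by (intro rat_poly_fun_diff rat_poly_fun_var) auto
  have "rat_poly_fun (V \<times> {..<d}) (\<lambda>x::'a \<times> nat \<Rightarrow> real. (if P then 1 else 0) - (if Q then 1 else 0))" for P Q
    by (intro rat_poly_fun_diff) (auto intro: rat_poly_fun_0 rat_poly_fun_1)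
  then show ?thesis
    unfolding rigidity_row_def[abs_def] using lin by (intro rat_poly_fun_mult)
qed

text \<open>The edge lengths of \<open>p\<close> and \<open>q\<close> agree, so a basis of the rigidity matrix of \<open>p\<close>, which
  has the rank of the rigidity matrix of the complete graph at \<open>p\<close>, stays independent at \<open>q\<close>; the rank
  for the complete graph at \<open>q\<close> is not larger than at the generic \<open>p\<close>.\<close>

lemma equivalent_framework_derivation:
  assumes "finite V" and edges: "\<And>u v. {u, v} \<in> E \<Longrightarrow> u \<in> V \<and> v \<in> V"
    and gen: "generic d V p" and rigid: "rigid_framework d V E p"
    and equiv: "equivalent_frameworks d E p q" and D: "derivation D"
    and kill: "\<And>u v. {u, v} \<in> E \<Longrightarrow> D (sq_dist d (p u) (p v)) = 0"
    and ab: "a \<in> V" "b \<in> V"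
  shows "D (sq_dist d (q a) (q b)) = 0"
proof (rule ccontr)
  assume ne: "\<not> ?thesis"
  define J where "J = V \<times> {..<d}"
  have finJ: "finite J" unfolding J_def using \<open>finite V\<close> by simp
  define x where "x = (\<lambda>(v, i). p v i)"
  define y where "y = (\<lambda>(v, i). q v i)"
  have indep: "alg_indep_rat J x" using gen unfolding generic_def J_def x_def .
  define Ep where "Ep = {(u, v). {u, v} \<in> E}"
  have EpV: "u \<in> V" "v \<in> V" if "(u, v) \<in> Ep" for u v using that edges unfolding Ep_def by auto
  have "Ep \<subseteq> V \<times> V" using EpV by auto
  then have finEp: "finite Ep" using \<open>finite V\<close> finite_subset by blast
  have eq: "sq_dist d (q u) (q v) = sq_dist d (p u) (p v)" if "(u, v) \<in> Ep" for u v
    using equiv that unfolding equivalent_frameworks_def dist_d_eq_iff Ep_def by blast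
  have row_p: "D' (sq_dist d (p u) (p v)) = 2 * (\<Sum>j\<in>J. rigidity_row (u, v) j x * D' (x j))"
    if "derivation D'" "u \<in> V" "v \<in> V" for D' u v
    unfolding J_def rigidity_row_sum[OF \<open>finite V\<close> that(2,3)] derivation_sq_dist[OF that(1)] by (simp add: x_def)
  have row_q: "D' (sq_dist d (q u) (q v)) = 2 * (\<Sum>j\<in>J. rigidity_row (u, v) j y * D' (y j))"
    if "derivation D'" "u \<in> V" "v \<in> V" for D' u v
    unfolding J_def rigidity_row_sum[OF \<open>finite V\<close> that(2,3)] derivation_sq_dist[OF that(1)] by (simp add: y_def)
  obtain B where B: "B \<subseteq> Ep" "free_rows (\<lambda>e j. rigidity_row e j x) J B"
    and span: "\<And>z e. \<lbrakk>\<And>b. b \<in> B \<Longrightarrow> (\<Sum>j\<in>J. rigidity_row b j x * z j) = 0; e \<in> Ep\<rbrakk>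
      \<Longrightarrow> (\<Sum>j\<in>J. rigidity_row e j x * z j) = 0"
    using free_rows_basis[OF finEp, of "\<lambda>e j. rigidity_row e j x" J] by blast
  obtain z where z: "\<And>b c. b \<in> B \<Longrightarrow> c \<in> B \<Longrightarrow>
      (\<Sum>j\<in>J. rigidity_row c j x * z b j) = (if b = c then 1 else 0)"
    using B(2) unfolding free_rows_def by blast
  \<comment> \<open>The dual vectors at \<open>p\<close> are realized by derivations. These also act
    on the coordinates of \<open>q\<close> and, as edge lengths agree, form a dual system for the
    same rows there.\<close>
  have "\<forall>b. \<exists>D'. derivation D' \<and> (\<forall>j\<in>J. D' (x j) = z b j)"
    using alg_indep_rat_derivation[OF indep] by metis
  from choice[OF this] obtain \<D> where \<D>: "\<And>b. derivation (\<D> b)" "\<And>b j. j \<in> J \<Longrightarrow> \<D> b (x j) = z b j"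
    by blast
  have "free_rows (\<lambda>e j. rigidity_row e j y) J B"
    unfolding free_rows_def
  proof (intro exI ballI)
    fix b c assume bc: "b \<in> B" "c \<in> B"
    obtain u v where c: "c = (u, v)" by force
    then have uv: "(u, v) \<in> Ep" using bc B(1) by blast
    have "2 * (\<Sum>j\<in>J. rigidity_row c j y * \<D> b (y j)) = \<D> b (sq_dist d (p u) (p v))"
      using row_q[OF \<D>(1), of u v b] EpV[OF uv] eq[OF uv] c by simp
    also have "\<dots> = 2 * (\<Sum>j\<in>J. rigidity_row c j x * z b j)"
      using row_p[OF \<D>(1), of u v b] EpV[OF uv] \<D>(2) c by simp
    finally show "(\<Sum>j\<in>J. rigidity_row c j y * \<D> b (y j)) = (if b = c then 1 else 0)"
      using z[OF bc] by simp
  qed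
  moreover have kill_q: "(\<Sum>j\<in>J. rigidity_row c j y * D (y j)) = 0" if "c \<in> B" for c
  proof -
    obtain u v where c: "c = (u, v)" by force
    then have uv: "(u, v) \<in> Ep" using that B(1) by blast
    then have "D (sq_dist d (q u) (q v)) = 0" using kill eq unfolding Ep_def by simp
    then show ?thesis using row_q[OF D, of u v] EpV[OF uv] c by simp
  qed
  moreover have ne': "(\<Sum>j\<in>J. rigidity_row (a, b) j y * D (y j)) \<noteq> 0"
    using ne row_q[OF D ab] by simp
  ultimately have "free_rows (\<lambda>e j. rigidity_row e j y) J (insert (a, b) B)"
    by (rule free_rows_insert)
  \<comment> \<open>Independence passes from \<open>q\<close> to the generic \<open>p\<close>, even
    for a row that need not be an edge.\<close>
  then have "free_rows (\<lambda>e j. rigidity_row e j x) J (insert (a, b) B)"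
  proof (rule free_rows_generic[OF indep finJ, rotated 2])
    show "finite (insert (a, b) B)" using finite_subset[OF B(1) finEp] by simp
    fix e j assume "e \<in> insert (a, b) B" "j \<in> J"
    moreover from this have "fst e \<in> V" "snd e \<in> V" using B(1) EpV ab by (cases e; auto)+
    ultimately show "rat_poly_fun J (rigidity_row e j)"
      unfolding J_def by (intro rat_poly_fun_rigidity_row)
  qed
  then obtain w where w: "\<And>b' c. b' \<in> insert (a, b) B \<Longrightarrow> c \<in> insert (a, b) B \<Longrightarrow>
      (\<Sum>j\<in>J. rigidity_row c j x * w b' j) = (if b' = c then 1 else 0)"
    unfolding free_rows_def by blast
  \<comment> \<open>The dual vector of \<open>(a, b)\<close> at \<open>p\<close> becomes a
    derivation that kills every edge length but moves this pair, against rigidity.\<close>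
  obtain D' where D': "derivation D'" "\<And>j. j \<in> J \<Longrightarrow> D' (x j) = w (a, b) j"
    using alg_indep_rat_derivation[OF indep] by blast
  have abB: "(a, b) \<notin> B" using kill_q ne' by blast
  have "(\<Sum>j\<in>J. rigidity_row c j x * w (a, b) j) = 0" if "c \<in> B" for c
    using w[of "(a, b)" c] that abB by auto
  then have flex: "(\<Sum>j\<in>J. rigidity_row e j x * w (a, b) j) = 0" if "e \<in> Ep" for e
    using span that by blast
  have "D' (sq_dist d (p a) (p b)) = 0"
  proof (rule rigid_framework_derivation[OF \<open>finite V\<close> edges rigid D'(1) _ ab])
    fix u v assume "{u, v} \<in> E"
    then have uv: "(u, v) \<in> Ep" unfolding Ep_def by simp
    show "D' (sq_dist d (p u) (p v)) = 0"
      using row_p[OF D'(1), of u v] EpV[OF uv] flex[OF uv] D'(2) by simp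
  qed
  moreover have "D' (sq_dist d (p a) (p b)) = 2"
    using row_p[OF D'(1) ab] w[of "(a, b)" "(a, b)"] D'(2) by simp
  ultimately show False by simp
qed

text \<open>Induction on the dimension. A reflection carries a nonzero point of \<open>N\<close>
  onto the last axis; on \<open>N\<close> the last coordinates become inner products divided by its
  length \<open>r\<close>, which is why square roots are needed. Indices outside \<open>N\<close>
  are carried along by the same isometry, so the position of \<open>v\<close> relative to the others
  survives.\<close>

lemma isometric_copy_over_subfield:
  fixes F :: "real set" and c :: "'m \<Rightarrow> nat \<Rightarrow> real"
  assumes F: "0 \<in> F" "\<And>x y. x \<in> F \<Longrightarrow> y \<in> F \<Longrightarrow> x - y \<in> F" "\<And>x y. x \<in> F \<Longrightarrow> y \<in> F \<Longrightarrow> x * y \<in> F"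
    "\<And>x y. x \<in> F \<Longrightarrow> y \<in> F \<Longrightarrow> x / y \<in> F" "\<And>x. x \<in> F \<Longrightarrow> 0 \<le> x \<Longrightarrow> sqrt x \<in> F"
    and dots: "\<And>i j. i \<in> N \<Longrightarrow> j \<in> N \<Longrightarrow> dot d (c i) (c j) \<in> F"
  shows "\<exists>c'. (\<forall>i j. dot d (c' i) (c' j) = dot d (c i) (c j)) \<and> (\<forall>i\<in>N. \<forall>k<d. c' i k \<in> F)"
  using dots
proof (induction d arbitrary: c)
  case 0
  show ?case by (intro exI[of _ c]) simp
next
  case (Suc d)
  show ?case
  proof (cases "\<forall>i\<in>N. \<forall>k<Suc d. c i k = 0")
    case True
    then show ?thesis using F(1) by (intro exI[of _ c]) auto
  next
    case False
    then obtain i0 where i0: "i0 \<in> N" "dot (Suc d) (c i0) (c i0) \<noteq> 0" by (auto simp: dot_self_eq_0_iff)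
    define r where "r = sqrt (dot (Suc d) (c i0) (c i0))"
    have r2: "r * r = dot (Suc d) (c i0) (c i0)" unfolding r_def using dot_nonneg by simp
    have r: "r \<noteq> 0" "r \<in> F" using i0 r2 Suc.prems F(5) dot_nonneg unfolding r_def by auto
    define b where "b k = (if k = d then r else 0)" for k
    have dot_b: "dot (Suc d) x b = x d * r" for x
      unfolding dot_def b_def by (simp add: if_distrib cong: if_cong)
    define n where "n k = c i0 k - b k" for k
    define nn where "nn = dot (Suc d) n n"
    \<comment> \<open>The Householder reflection taking \<open>c i0\<close> to \<open>b\<close>. For
      \<open>nn = 0\<close> division by zero makes it the identity, as it should be.\<close>
    define e where "e i k = c i k - (2 * dot (Suc d) (c i) n / nn) * n k" for i k
    have dot_e: "dot (Suc d) (e i) (e j) = dot (Suc d) (c i) (c j)" for i j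
      unfolding e_def dot_diff_left dot_diff_right dot_scale_left dot_scale_right nn_def[symmetric]
      by (cases "nn = 0") (simp_all add: dot_commute field_simps)
    have e0: "e i0 k = b k" if "k < Suc d" for k
    proof (cases "nn = 0")
      case True
      then have "n k = 0" using that unfolding nn_def by (simp add: dot_self_eq_0_iff)
      then show ?thesis unfolding e_def n_def by simp
    next
      case False
      have "2 * dot (Suc d) (c i0) n = nn"
        unfolding nn_def n_def dot_diff_left dot_diff_right
        by (simp add: dot_commute dot_b r2[symmetric] algebra_simps, simp add: b_def)
      then show ?thesis using False unfolding e_def n_def by simp
    qed
    have last: "e i d \<in> F" if "i \<in> N" for i
    proof -
      have "dot (Suc d) (c i) (c i0) = dot (Suc d) (e i) b"
        unfolding dot_e[symmetric] by (rule dot_cong) (auto simp: e0)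
      then have "e i d = dot (Suc d) (c i) (c i0) / r" using r(1) by (simp add: dot_b)
      then show ?thesis using F(4) Suc.prems that i0 r by simp
    qed
    have dot_Suc: "dot (Suc d) x y = dot d x y + x d * y d" for x y
      unfolding dot_def by simp
    have "dot d (e i) (e j) \<in> F" if "i \<in> N" "j \<in> N" for i j
    proof -
      have "dot d (e i) (e j) = dot (Suc d) (c i) (c j) - e i d * e j d"
        using dot_e[of i j] by (simp add: dot_Suc)
      then show ?thesis using F(2,3) Suc.prems last that by simp
    qed
    then obtain f where f: "\<And>i j. dot d (f i) (f j) = dot d (e i) (e j)" "\<And>i k. i \<in> N \<Longrightarrow> k < d \<Longrightarrow> f i k \<in> F"
      using Suc.IH[of e] by blast
    define g where "g i k = (if k < d then f i k else e i d)" for i k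
    have "dot d (g i) (g j) = dot d (f i) (f j)" for i j
      by (rule dot_cong) (auto simp: g_def)
    then have "dot (Suc d) (g i) (g j) = dot (Suc d) (c i) (c j)" for i j
      using dot_e[of i j] f(1)[of i j] by (simp add: dot_Suc) (simp add: g_def)
    moreover have "g i k \<in> F" if "i \<in> N" "k < Suc d" for i k
      using f(2) last that unfolding g_def by simp
    ultimately show ?thesis by blast
  qed
qed

text \<open>Differentiating \<open>w \<bullet> c\<^sub>i = u \<bullet> a\<^sub>i + const\<close> expresses the \<open>a\<^sub>i\<close> as the images of the
  \<open>c\<^sub>i\<close> under a constant matrix \<open>W\<close>; differentiating \<open>w \<bullet> w = u \<bullet> u\<close> twice shows that \<open>W\<close> is
  orthogonal.\<close>

lemma star_congruence:
  fixes a c :: "nat \<Rightarrow> nat \<Rightarrow> real" and u w :: "nat \<Rightarrow> real"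
  assumes D: "\<And>m. derivation (D m)"
    and Da: "\<And>m i k. m < d \<Longrightarrow> i < d \<Longrightarrow> k < d \<Longrightarrow> D m (a i k) = 0"
    and Dc: "\<And>m i k. m < d \<Longrightarrow> i < d \<Longrightarrow> k < d \<Longrightarrow> D m (c i k) = 0"
    and Du: "\<And>m k. m < d \<Longrightarrow> k < d \<Longrightarrow> D m (u k) = (if m = k then 1 else 0)"
    and center: "dot d w w = dot d u u"
    and star: "\<And>i. i < d \<Longrightarrow> sq_dist d w (c i) = sq_dist d u (a i)"
    and inv: "\<And>i j. i < d \<Longrightarrow> j < d \<Longrightarrow> (\<Sum>k<d. a i k * s k j) = (if i = j then 1 else 0)"
    and ij: "i < d" "j < d"
  shows "dot d (c i) (c j) = dot d (a i) (a j)"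
proof -
  define W where "W m l = D m (w l)" for m l
  have dot_e: "dot d x (\<lambda>k. if m = k then 1 else 0) = x m" if "m < d" for x m
    unfolding dot_def using that by (simp add: if_distrib cong: if_cong)
  have wW: "dot d w (W m) = u m" if "m < d" for m
  proof -
    have "2 * dot d w (W m) = D m (dot d w w)" unfolding W_def derivation_dot_self[OF D] ..
    also have "\<dots> = 2 * dot d u (\<lambda>k. D m (u k))" unfolding center derivation_dot_self[OF D] ..
    also have "dot d u (\<lambda>k. D m (u k)) = dot d u (\<lambda>k. if m = k then 1 else 0)"
      by (rule dot_cong) (use Du that in auto)
    finally show ?thesis using dot_e[OF that] by simp
  qed
  have A: "dot d (c i) (W m) = a i m" if "i < d" "m < d" for i m
  proof -
    have "D m (sq_dist d w (c i)) = D m (sq_dist d u (a i))" using star[OF that(1)] by simp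
    then have "dot d (\<lambda>k. w k - c i k) (\<lambda>k. D m (w k) - D m (c i k))
        = dot d (\<lambda>k. u k - a i k) (\<lambda>k. D m (u k) - D m (a i k))"
      unfolding derivation_sq_dist[OF D] by simp
    also have "dot d (\<lambda>k. w k - c i k) (\<lambda>k. D m (w k) - D m (c i k)) = dot d (\<lambda>k. w k - c i k) (W m)"
      by (rule dot_cong) (use Dc that in \<open>auto simp: W_def\<close>)
    also have "dot d (\<lambda>k. u k - a i k) (\<lambda>k. D m (u k) - D m (a i k)) = dot d (\<lambda>k. u k - a i k) (\<lambda>k. if m = k then 1 else 0)"
      by (rule dot_cong) (use Da Du that in auto)
    also have "\<dots> = u m - a i m" using dot_e[OF that(2)] .
    finally have "dot d w (W m) - dot d (c i) (W m) = u m - a i m" by (simp add: dot_diff_left)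
    then show ?thesis using wW[OF that(2)] by simp
  qed
  define X where "X l j = (\<Sum>k<d. W k l * s k j)" for l j
  have CX: "(\<Sum>l<d. c i l * X l j) = (if i = j then 1 else 0)" if "i < d" "j < d" for i j
  proof -
    have "(\<Sum>l<d. c i l * X l j) = (\<Sum>k<d. (\<Sum>l<d. c i l * W k l) * s k j)"
      unfolding X_def sum_distrib_left sum_distrib_right by (subst sum.swap) (simp add: mult.assoc)
    also have "\<dots> = (\<Sum>k<d. a i k * s k j)"
      using A[OF that(1)] unfolding dot_def by (intro sum.cong) auto
    finally show ?thesis using inv[OF that] by simp
  qed
  have XC: "(\<Sum>i<d. X l i * c i l') = (if l = l' then 1 else 0)" if "l < d" "l' < d" for l l'
    using square_matrix_inverse_commute[of d c X, OF CX that] .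
  \<comment> \<open>The products of \<open>W m\<close> with the \<open>c i\<close> are the constants
    \<open>a i m\<close>, and the matrix of the \<open>c i\<close> is invertible and
    constant.\<close>
  have DW: "D n (W m l) = 0" if "n < d" "m < d" "l < d" for n m l
  proof -
    have zero: "(\<Sum>l'<d. c i l' * D n (W m l')) = 0" if i: "i < d" for i
    proof -
      have "dot d (\<lambda>k. D n (c i k)) (W m) + dot d (c i) (\<lambda>k. D n (W m k)) = D n (a i m)"
        using A[OF i \<open>m < d\<close>] derivation_dot[OF D, of n d "c i" "W m"] by simp
      moreover have "dot d (\<lambda>k. D n (c i k)) (W m) = 0"
        unfolding dot_def using Dc[OF \<open>n < d\<close> i] by simp
      ultimately show ?thesis using Da[OF \<open>n < d\<close> i \<open>m < d\<close>] unfolding dot_def by simp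
    qed
    have "D n (W m l) = (\<Sum>l'<d. (\<Sum>i<d. X l i * c i l') * D n (W m l'))"
      using XC[OF \<open>l < d\<close>] \<open>l < d\<close> by (simp add: if_distrib[of "\<lambda>x. x * _"] cong: if_cong)
    also have "\<dots> = (\<Sum>i<d. X l i * (\<Sum>l'<d. c i l' * D n (W m l')))"
      unfolding sum_distrib_left sum_distrib_right by (subst sum.swap) (simp add: mult.assoc)
    finally show ?thesis using zero by simp
  qed
  \<comment> \<open>The second differentiation, applied to \<open>wW\<close>; by \<open>DW\<close>
    only the product of the two gradients remains.\<close>
  have WW: "(\<Sum>l<d. W n l * W m l) = (if n = m then 1 else 0)" if "n < d" "m < d" for n m
  proof -
    have "dot d (W n) (W m) + dot d w (\<lambda>l. D n (W m l)) = D n (u m)"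
      using wW[OF that(2)] derivation_dot[OF D, of n d w "W m"] unfolding W_def by simp
    moreover have "dot d w (\<lambda>l. D n (W m l)) = 0"
      unfolding dot_def using DW that by simp
    ultimately show ?thesis using Du that unfolding dot_def by simp
  qed
  have WtW: "(\<Sum>k<d. W k l * W k l') = (if l = l' then 1 else 0)" if "l < d" "l' < d" for l l'
    using square_matrix_inverse_commute[of d W "\<lambda>k l. W l k", OF WW that] .
  have "dot d (a i) (a j) = (\<Sum>k<d. (\<Sum>l<d. c i l * W k l) * (\<Sum>l'<d. c j l' * W k l'))"
    unfolding dot_def using A[OF ij(1)] A[OF ij(2)] unfolding dot_def by (intro sum.cong) auto
  also have "\<dots> = (\<Sum>k<d. \<Sum>l<d. \<Sum>l'<d. c i l * c j l' * (W k l * W k l'))"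
    unfolding sum_product by (simp add: mult_ac)
  also have "\<dots> = (\<Sum>l<d. \<Sum>k<d. \<Sum>l'<d. c i l * c j l' * (W k l * W k l'))" by (rule sum.swap)
  also have "\<dots> = (\<Sum>l<d. \<Sum>l'<d. c i l * c j l' * (\<Sum>k<d. W k l * W k l'))"
    unfolding sum_distrib_left by (subst sum.swap) (rule refl)
  also have "\<dots> = (\<Sum>l<d. \<Sum>l'<d. if l = l' then c i l * c j l' else 0)"
    by (intro sum.cong) (use WtW in auto)
  also have "\<dots> = dot d (c i) (c j)" unfolding dot_def by simp
  finally show ?thesis by simp
qed

section \<open>Recovering the distances at a deleted vertex\<close>

lemma generic_mono: "generic d V p \<Longrightarrow> W \<subseteq> V \<Longrightarrow> generic d W p"
  unfolding generic_def by (rule alg_indep_rat_mono) auto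

text \<open>A generic simplex inherits independence from the standard simplex with apex \<open>a\<close> at the
  origin.\<close>

lemma generic_simplex_inverse:
  assumes gen: "generic d V p" and h: "bij_betw h {..<d} T" and T: "T \<subseteq> V - {a}" and a: "a \<in> V"
  obtains s where "\<And>i j. i < d \<Longrightarrow> j < d \<Longrightarrow> (\<Sum>k<d. (p (h i) k - p a k) * s k j) = (if i = j then 1 else 0)"
proof -
  define x where "x = (\<lambda>(v, i). p v i)"
  define M where "M i k y = y (h i, k) - y (a, k)" for i k and y :: "'a \<times> nat \<Rightarrow> real"
  define y where "y = (\<lambda>(w, k). if w \<noteq> a \<and> w = h k then 1 else (0::real))"
  have hT: "h i \<in> T" if "i < d" for i using h that unfolding bij_betw_def by auto
  have "free_rows (\<lambda>i k. M i k x) {..<d} {..<d}"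
  proof (rule free_rows_generic[of "V \<times> {..<d}" x _ _ M y])
    show "alg_indep_rat (V \<times> {..<d}) x" using gen unfolding generic_def x_def .
    show "rat_poly_fun (V \<times> {..<d}) (M i k)" if "i \<in> {..<d}" "k \<in> {..<d}" for i k
      unfolding M_def[abs_def] using that hT[of i] T a
      by (intro rat_poly_fun_diff rat_poly_fun_var) auto
    have My: "M i k y = (if i = k then 1 else 0)" if "i < d" "k < d" for i k
      using h hT[OF that(1)] T that unfolding M_def y_def bij_betw_def inj_on_def by auto
    show "free_rows (\<lambda>i k. M i k y) {..<d} {..<d}"
      unfolding free_rows_def
    proof (intro exI ballI)
      fix b c assume bc: "b \<in> {..<d}" "c \<in> {..<d}"
      have "(\<Sum>k<d. M c k y * (if k = b then 1 else 0)) = M c b y" using bc by (simp add: if_distrib cong: if_cong)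
      then show "(\<Sum>k<d. M c k y * (if k = b then 1 else 0)) = (if b = c then 1 else 0)"
        using My bc by auto
    qed
  qed auto
  then obtain z where "\<And>b c. b < d \<Longrightarrow> c < d \<Longrightarrow> (\<Sum>k<d. M c k x * z b k) = (if b = c then 1 else 0)"
    unfolding free_rows_def by (meson lessThan_iff)
  then show ?thesis using that[of "\<lambda>k j. z j k"] unfolding M_def x_def by auto
qed

text \<open>The prescribed \<open>b\<close> is put into \<open>T\<close>, so congruence of this one
  simplex with apex \<open>a\<close> settles the distance between \<open>a\<close> and
  \<open>b\<close>.\<close>

lemma obtain_simplex:
  assumes "finite N" "d + 1 \<le> card N" "a \<in> N" "b \<in> N" "a \<noteq> b" "0 < d"
  obtains h T where "bij_betw h {..<d::nat} T" "T \<subseteq> N - {a}" "b \<in> T"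
proof -
  have "d - 1 \<le> card (N - {a, b})" using assms by (simp add: card_Diff_subset)
  then obtain S where S: "S \<subseteq> N - {a, b}" "card S = d - 1" by (meson obtain_subset_with_card_n)
  have finS: "finite S" using S(1) assms(1) by (meson finite_Diff finite_subset)
  have "card (insert b S) = d" using S finS assms(6) by (subst card_insert_disjoint) auto
  then obtain h where "bij_betw h {..<d} (insert b S)"
    using ex_bij_betw_nat_finite[of "insert b S"] finS by (auto simp: atLeast0LessThan)
  then show ?thesis using that[of h "insert b S"] S assms by blast
qed

text \<open>The derivations \<open>D m\<close> freeze \<open>p\<close> except at \<open>v\<close>,
  where they move along the axes. By rigidity off \<open>v\<close>, the distances of
  \<open>q\<close> there lie in the field \<open>F\<close> of constants; after an isometry the
  simplex on \<open>T\<close> has coordinates in \<open>F\<close>, and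
  \<open>star_congruence\<close> applies.\<close>

lemma nbrs_congruent:
  assumes G: "simple_graph V E" and v: "v \<in> V" and gen: "generic d V p"
    and rigid: "rigid_framework d (V - {v}) {e \<in> E. v \<notin> e} p"
    and equiv: "equivalent_frameworks d E p q"
    and deg: "d + 1 \<le> card (nbrs E v)" and a: "a \<in> nbrs E v" and b: "b \<in> nbrs E v"
  shows "sq_dist d (q a) (q b) = sq_dist d (p a) (p b)"
proof (cases "a = b \<or> d = 0")
  case True
  then show ?thesis by (auto simp: sq_dist_def)
next
  case False
  then have ab: "a \<noteq> b" and d: "0 < d" by auto
  have finV: "finite V" using G unfolding simple_graph_def by simp
  have N: "nbrs E v \<subseteq> V - {v}" by (rule nbrs_subset[OF G])
  have finN: "finite (nbrs E v)" using N finV by (meson finite_Diff finite_subset)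
  have edge: "sq_dist d (q x) (q y) = sq_dist d (p x) (p y)" if "{x, y} \<in> E" for x y
    using equiv that unfolding equivalent_frameworks_def dist_d_eq_iff by blast
  obtain h T where h: "bij_betw h {..<d} T" and T: "T \<subseteq> nbrs E v - {a}" and bT: "b \<in> T"
    using obtain_simplex[OF finN deg a b ab d] .
  have hT: "h i \<in> T" if "i < d" for i using h that unfolding bij_betw_def by auto
  have TV: "T \<subseteq> V - {v}" using T N by blast
  have aV: "a \<in> V - {v}" using a N by blast
  obtain s where s: "\<And>i j. i < d \<Longrightarrow> j < d \<Longrightarrow> (\<Sum>k<d. (p (h i) k - p a k) * s k j) = (if i = j then 1 else 0)"
    using generic_simplex_inverse[OF gen h, of a] TV T N aV by blast
  define x where "x = (\<lambda>(v, i). p v i)"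
  have indep: "alg_indep_rat (V \<times> {..<d}) x" using gen unfolding generic_def x_def .
  define z where "z m j = (if j = (v, m) then 1 else 0 :: real)" for m and j :: "'a \<times> nat"
  have "\<forall>m. \<exists>D. derivation D \<and> (\<forall>j\<in>V \<times> {..<d}. D (x j) = z m j)"
    using alg_indep_rat_derivation[OF indep] by metis
  from choice[OF this] obtain D where D: "\<And>m. derivation (D m)"
    and Dx: "\<And>m j. j \<in> V \<times> {..<d} \<Longrightarrow> D m (x j) = z m j"
    by blast
  have Dw: "D m (p w k) = 0" if "w \<in> V - {v}" "k < d" for m w k
    using Dx[of "(w, k)" m] that by (auto simp: x_def z_def)
  have Dv: "D m (p v k) = (if m = k then 1 else 0)" if "k < d" for m k
    using Dx[of "(v, k)" m] that v by (auto simp: x_def z_def)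
  note Drules = derivation_rules[OF D]
  define F where "F = {x. \<forall>m. D m x = 0}"
  have Fdiff: "x - y \<in> F" and Fmult: "x * y \<in> F" if "x \<in> F" "y \<in> F" for x y
    using that unfolding F_def by (auto simp: Drules)
  have Fdiv: "x / y \<in> F" if "x \<in> F" "y \<in> F" for x y
  proof (cases "y = 0")
    case False
    have "D m (x / y) = 0" for m
    proof -
      have "D m (x / y) * y = D m (x / y * y)" using that unfolding F_def Drules(2) by simp
      also have "\<dots> = 0" using that False unfolding F_def by simp
      finally show ?thesis using False by simp
    qed
    then show ?thesis unfolding F_def by blast
  qed (simp add: F_def Drules)
  have Fsqrt: "sqrt x \<in> F" if "x \<in> F" "0 \<le> x" for x
  proof (cases "x = 0")
    case False
    have "D m (sqrt x) = 0" for m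
    proof -
      have "2 * sqrt x * D m (sqrt x) = D m ((sqrt x)\<^sup>2)" by (simp only: Drules)
      also have "\<dots> = 0" using that unfolding F_def by simp
      finally show ?thesis using False that by simp
    qed
    then show ?thesis unfolding F_def by blast
  qed (simp add: F_def Drules)
  have F_sq: "sq_dist d (q x) (q y) \<in> F" if "x \<in> V - {v}" "y \<in> V - {v}" for x y
    unfolding F_def
  proof (intro CollectI allI)
    fix m
    show "D m (sq_dist d (q x) (q y)) = 0"
    proof (rule equivalent_framework_derivation[OF _ _ generic_mono[OF gen] rigid _ D _ that])
      show "equivalent_frameworks d {e \<in> E. v \<notin> e} p q"
        using equiv unfolding equivalent_frameworks_def by blast
      fix x y assume "{x, y} \<in> {e \<in> E. v \<notin> e}"
      then show xy: "x \<in> V - {v} \<and> y \<in> V - {v}" using simple_graph_edge[OF G, of x y] by auto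
      show "D m (sq_dist d (p x) (p y)) = 0"
        unfolding derivation_sq_dist[OF D] dot_def using Dw xy by simp
    qed (use finV in auto)
  qed
  \<comment> \<open>Translating \<open>q a\<close> to the origin makes distances to \<open>a\<close>
    into lengths, so all inner products on \<open>T\<close> are expressed by distances off
    \<open>v\<close>.\<close>
  define c0 where "c0 x k = q x k - q a k" for x k
  have c0_dist: "sq_dist d (c0 x) (c0 y) = sq_dist d (q x) (q y)" for x y
    unfolding sq_dist_def c0_def by simp
  have c0_self: "dot d (c0 x) (c0 x) = sq_dist d (q x) (q a)" for x
    unfolding sq_dist_eq_dot c0_def by simp
  have polar: "sq_dist d x y = dot d x x - 2 * dot d x y + dot d y y" for x y
    unfolding sq_dist_eq_dot dot_diff_left dot_diff_right by (simp add: dot_commute)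
  have "0 \<in> F" unfolding F_def by (simp add: Drules)
  moreover have "1 \<in> F" unfolding F_def by (simp add: Drules)
  ultimately have Fadd: "x + y \<in> F" if "x \<in> F" "y \<in> F" for x y
    using that unfolding F_def by (simp add: Drules)
  have F2: "2 \<in> F" using Fadd[OF \<open>1 \<in> F\<close> \<open>1 \<in> F\<close>] by simp
  have dots: "dot d (c0 x) (c0 y) \<in> F" if "x \<in> T" "y \<in> T" for x y
  proof -
    have "dot d (c0 x) (c0 y) = (sq_dist d (q x) (q a) + sq_dist d (q y) (q a) - sq_dist d (q x) (q y)) / 2"
      using polar[of "c0 x" "c0 y"] by (simp add: c0_dist c0_self)
    also have "\<dots> \<in> F" using that TV aV by (intro Fdiv Fdiff Fadd F_sq F2) auto
    finally show ?thesis .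
  qed
  have "\<exists>c. (\<forall>x y. dot d (c x) (c y) = dot d (c0 x) (c0 y)) \<and> (\<forall>x\<in>T. \<forall>k<d. c x k \<in> F)"
    by (rule isometric_copy_over_subfield[OF \<open>0 \<in> F\<close> Fdiff Fmult Fdiv Fsqrt dots])
  then obtain c where c: "\<And>x y. dot d (c x) (c y) = dot d (c0 x) (c0 y)" "\<And>x k. x \<in> T \<Longrightarrow> k < d \<Longrightarrow> c x k \<in> F"
    by blast
  have c_dist: "sq_dist d (c x) (c y) = sq_dist d (q x) (q y)" for x y
    using polar[of "c x" "c y"] polar[of "c0 x" "c0 y"] by (simp add: c c0_dist)
  define u where "u k = p v k - p a k" for k
  define e where "e i k = p (h i) k - p a k" for i k
  obtain j where j: "j < d" "b = h j" using bT h unfolding bij_betw_def by auto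
  have "dot d (c (h j)) (c (h j)) = dot d (e j) (e j)"
  proof (rule star_congruence[of D d e "\<lambda>i. c (h i)" u "c v" s])
    show "D m (e i k) = 0" if "m < d" "i < d" "k < d" for m i k
      unfolding e_def Drules using Dw[of "h i"] Dw[of a] hT TV aV that by (simp add: subset_iff)
    show "D m (c (h i) k) = 0" if "m < d" "i < d" "k < d" for m i k
      using c(2)[OF hT] that unfolding F_def by simp
    show "D m (u k) = (if m = k then 1 else 0)" if "m < d" "k < d" for m k
      unfolding u_def Drules using Dv Dw[of a] aV that by simp
    have "{v, a} \<in> E" using a unfolding nbrs_def by simp
    from edge[OF this] have "sq_dist d (q v) (q a) = sq_dist d (p v) (p a)" .
    then show "dot d (c v) (c v) = dot d u u"
      by (simp add: c c0_self u_def[abs_def] sq_dist_eq_dot)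
    show "sq_dist d (c v) (c (h i)) = sq_dist d u (e i)" if "i < d" for i
    proof -
      have "{v, h i} \<in> E" using hT[OF that] T unfolding nbrs_def by auto
      from edge[OF this] show ?thesis unfolding c_dist by (simp add: sq_dist_def u_def e_def)
    qed
    show "(\<Sum>k<d. e i k * s k j) = (if i = j then 1 else 0)" if "i < d" "j < d" for i j
      using s[OF that] unfolding e_def .
  qed (use D j in auto)
  then have "sq_dist d (q b) (q a) = sq_dist d (p b) (p a)"
    by (simp add: c c0_self j(2) e_def[abs_def] sq_dist_eq_dot)
  then show ?thesis by (simp add: sq_dist_commute)
qed

text \<open>By \<open>nbrs_congruent\<close> the clique edges also keep their lengths, so
  \<open>q\<close> is congruent to \<open>p\<close> off \<open>v\<close>. The distances from
  \<open>v\<close> to \<open>a\<close> and \<open>T\<close> fix the others, because each vertex is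
  an affine combination of that simplex with the same coefficients in both frameworks.\<close>

theorem globally_rigid_framework_eliminate:
  assumes G: "simple_graph V E" and v: "v \<in> V" and gen: "generic d V p"
    and rigid: "rigid_framework d (V - {v}) {e \<in> E. v \<notin> e} p"
    and glob: "globally_rigid_framework d (V - {v}) (eliminate v E) p"
    and deg: "d + 1 \<le> card (nbrs E v)" and "0 < d"
  shows "globally_rigid_framework d V E p"
  unfolding globally_rigid_framework_def
proof (intro allI impI)
  fix q assume equiv: "equivalent_frameworks d E p q"
  have finV: "finite V" using G unfolding simple_graph_def by simp
  have N: "nbrs E v \<subseteq> V - {v}" by (rule nbrs_subset[OF G])
  have finN: "finite (nbrs E v)" using N finV by (meson finite_Diff finite_subset)
  have edge: "sq_dist d (q x) (q y) = sq_dist d (p x) (p y)" if "{x, y} \<in> E" for x y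
    using equiv that unfolding equivalent_frameworks_def dist_d_eq_iff by blast
  have "equivalent_frameworks d (eliminate v E) p q"
    unfolding equivalent_frameworks_def dist_d_eq_iff
  proof (intro allI impI)
    fix x y assume "{x, y} \<in> eliminate v E"
    then consider "{x, y} \<in> E" | "x \<in> nbrs E v" "y \<in> nbrs E v"
      unfolding eliminate_def by (auto simp: doubleton_eq_iff)
    then show "sq_dist d (q x) (q y) = sq_dist d (p x) (p y)"
      by cases (use edge nbrs_congruent[OF G v gen rigid equiv deg] in auto)
  qed
  then have "congruent_frameworks d (V - {v}) p q"
    using glob unfolding globally_rigid_framework_def by blast
  then have cong: "sq_dist d (q x) (q y) = sq_dist d (p x) (p y)" if "x \<in> V - {v}" "y \<in> V - {v}" for x y
    using that unfolding congruent_frameworks_def dist_d_eq_iff by blast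
  have "2 \<le> card (nbrs E v)" using deg \<open>0 < d\<close> by simp
  then obtain a b where ab: "a \<in> nbrs E v" "b \<in> nbrs E v" "a \<noteq> b"
    by (meson card_2_iff' ex_card subsetD)
  obtain h T where h: "bij_betw h {..<d} T" and T: "T \<subseteq> nbrs E v - {a}"
    using obtain_simplex[OF finN deg ab \<open>0 < d\<close>] by blast
  have hT: "h i \<in> T" if "i < d" for i using h that unfolding bij_betw_def by auto
  have TV: "T \<subseteq> V - {v}" using T N by blast
  have aV: "a \<in> V - {v}" using ab N by blast
  obtain s where s: "\<And>i j. i < d \<Longrightarrow> j < d \<Longrightarrow> (\<Sum>k<d. (p (h i) k - p a k) * s k j) = (if i = j then 1 else 0)"
    using generic_simplex_inverse[OF gen h, of a] TV T N aV by blast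
  define P where "P x k = p x k - p a k" for x k
  define Q where "Q x k = q x k - q a k" for x k
  have va: "{v, a} \<in> E" using ab unfolding nbrs_def by simp
  have polarP: "sq_dist d (p x) (p y) = dot d (P x) (P x) - 2 * dot d (P x) (P y) + dot d (P y) (P y)" for x y
    unfolding P_def[abs_def] by (rule sq_dist_polar)
  have polarQ: "sq_dist d (q x) (q y) = dot d (Q x) (Q x) - 2 * dot d (Q x) (Q y) + dot d (Q y) (Q y)" for x y
    unfolding Q_def[abs_def] by (rule sq_dist_polar)
  have self: "dot d (Q x) (Q x) = dot d (P x) (P x)" if "x \<in> V" for x
  proof -
    have "sq_dist d (q x) (q a) = sq_dist d (p x) (p a)" using cong[OF _ aV, of x] edge[OF va] that by (cases "x = v") auto
    then show ?thesis unfolding P_def[abs_def] Q_def[abs_def] sq_dist_eq_dot .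
  qed
  have dots: "dot d (Q x) (Q y) = dot d (P x) (P y)"
    if "sq_dist d (q x) (q y) = sq_dist d (p x) (p y)" "x \<in> V" "y \<in> V" for x y
    using that polarP[of x y] polarQ[of x y] self by simp
  have star: "sq_dist d (q v) (q w) = sq_dist d (p v) (p w)" if w: "w \<in> V - {v}" for w
  proof -
    \<comment> \<open>Coordinates of \<open>P w\<close> in the basis \<open>P (h i)\<close>,
      computed with the inverse matrix \<open>s\<close>.\<close>
    define l where "l i = (\<Sum>j<d. P w j * s j i)" for i
    have Pw: "P w k = (\<Sum>i<d. l i * P (h i) k)" if "k < d" for k
    proof -
      have inv: "(\<Sum>i<d. s j i * P (h i) k) = (if j = k then 1 else 0)" if "j < d" for j
        unfolding P_def
        by (rule square_matrix_inverse_commute[of d "\<lambda>i k. p (h i) k - p a k" s, OF s that \<open>k < d\<close>])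
      have "(\<Sum>i<d. l i * P (h i) k) = (\<Sum>j<d. P w j * (\<Sum>i<d. s j i * P (h i) k))"
        unfolding l_def sum_distrib_left sum_distrib_right by (subst sum.swap) (simp add: mult.assoc)
      also have "\<dots> = (\<Sum>j<d. if j = k then P w k else 0)"
        by (intro sum.cong) (use inv in auto)
      finally show ?thesis using that by simp
    qed
    \<comment> \<open>The defect of the linear relation. Its length depends only on inner products
      that agree off \<open>v\<close>, so it vanishes for \<open>Q\<close> as it does for
      \<open>P\<close>.\<close>
    define R where "R X k = X w k - (\<Sum>i<d. l i * X (h i) k)" for X :: "'a \<Rightarrow> nat \<Rightarrow> real" and k
    have hV: "h i \<in> V - {v}" if "i < d" for i using hT that TV by blast
    have dots': "dot d (Q x) (Q y) = dot d (P x) (P y)" if "x \<in> V - {v}" "y \<in> V - {v}" for x y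
      using dots[OF cong[OF that]] that by blast
    have "dot d (R Q) (R Q) = dot d (R P) (R P)"
      unfolding R_def[abs_def] dot_diff_left dot_diff_right dot_sum_left dot_sum_right
      using dots'[OF hV hV] dots'[OF hV w] dots'[OF w hV] dots'[OF w w] by (simp cong: sum.cong_simp)
    also have "\<dots> = 0" unfolding dot_self_eq_0_iff R_def using Pw by simp
    finally have Qw: "Q w k = (\<Sum>i<d. l i * Q (h i) k)" if "k < d" for k
      using that unfolding dot_self_eq_0_iff R_def by simp
    have vh: "dot d (Q v) (Q (h i)) = dot d (P v) (P (h i))" if "i < d" for i
    proof (rule dots[OF edge])
      show "{v, h i} \<in> E" using hT[OF that] T unfolding nbrs_def by auto
    qed (use hV[OF that] v in auto)
    have "dot d (Q v) (Q w) = dot d (Q v) (\<lambda>k. \<Sum>i<d. l i * Q (h i) k)" by (rule dot_cong) (auto simp: Qw)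
    also have "\<dots> = dot d (P v) (\<lambda>k. \<Sum>i<d. l i * P (h i) k)"
      unfolding dot_sum_right using vh by simp
    also have "\<dots> = dot d (P v) (P w)" by (rule dot_cong) (auto simp: Pw)
    finally show ?thesis unfolding polarP polarQ using self w v by simp
  qed
  have "sq_dist d (q x) (q y) = sq_dist d (p x) (p y)" if "x \<in> V" "y \<in> V" for x y
    using that cong[of x y] star[of x] star[of y] by (cases "x = v"; cases "y = v") (auto simp: sq_dist_commute)
  then show "congruent_frameworks d V p q"
    unfolding congruent_frameworks_def dist_d_eq_iff by blast
qed

text \<open>The rigidity assumption speaks of graphs on natural numbers. An injection
  \<open>h\<close> moves a finite graph there, and its inverse \<open>g\<close> carries frameworks
  over.\<close>

lemma rigid_framework_transport:
  assumes rigid_nat: "\<And>(W :: nat set) F. simple_graph W F \<Longrightarrow> k_connected k W F \<Longrightarrow> rigid_graph d W F"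
    and G: "simple_graph V E" and conn: "k_connected k V E" and gen: "generic d V p"
  shows "rigid_framework d V E p"
proof -
  have finV: "finite V" using G unfolding simple_graph_def by simp
  obtain h :: "'a \<Rightarrow> nat" where h: "inj_on h V" using finite_imp_inj_to_nat_seg[OF finV] by blast
  define g where "g = inv_into V h"
  have gh: "g (h v) = v" if "v \<in> V" for v unfolding g_def using inv_into_f_f[OF h that] .
  define W where "W = h ` V"
  define F where "F = (`) h ` E"
  define P where "P n = p (g n)" for n
  have EV: "e \<subseteq> V" if "e \<in> E" for e using G that unfolding simple_graph_def by blast
  have edge: "{h x, h y} \<in> F \<longleftrightarrow> {x, y} \<in> E" if "x \<in> V" "y \<in> V" for x y
  proof
    assume "{h x, h y} \<in> F"
    then obtain e where e: "e \<in> E" "h ` e = h ` {x, y}" unfolding F_def by auto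
    then have "e = {x, y}" using inj_on_image_eq_iff[OF h EV[OF e(1)], of "{x, y}"] that by blast
    then show "{x, y} \<in> E" using e by blast
  next
    assume "{x, y} \<in> E"
    then have "h ` {x, y} \<in> F" unfolding F_def by blast
    then show "{h x, h y} \<in> F" by simp
  qed
  have sg: "simple_graph W F"
    unfolding simple_graph_def
  proof (intro conjI ballI)
    show "finite W" unfolding W_def using finV by simp
    fix f assume "f \<in> F"
    then obtain e where e: "e \<in> E" "f = h ` e" unfolding F_def by blast
    then show "f \<subseteq> W" using EV unfolding W_def by blast
    show "card f = 2" using e card_image[OF inj_on_subset[OF h EV[OF e(1)]]] G unfolding simple_graph_def by simp
  qed
  have "k_connected k W F"
  proof (rule k_connected_cutI[OF sg])
    show "k + 1 \<le> card W" unfolding W_def card_image[OF h] using conn unfolding k_connected_def by simp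
    fix S A B
    assume S: "S \<union> A \<union> B = W" "S \<inter> A = {}" "S \<inter> B = {}" "A \<inter> B = {}" "A \<noteq> {}" "B \<noteq> {}" "card S < k"
    define pre where "pre X = {v\<in>V. h v \<in> X}" for X
    have image_pre: "h ` pre X = X" if "X \<subseteq> W" for X using that unfolding pre_def W_def by auto
    have sub: "S \<subseteq> W" "A \<subseteq> W" "B \<subseteq> W" using S(1) by auto
    have "card (pre S) = card S"
      using card_image[OF inj_on_subset[OF h, of "pre S"]] image_pre[OF sub(1)] unfolding pre_def by auto
    moreover have "pre A \<noteq> {}" "pre B \<noteq> {}" using image_pre[OF sub(2)] image_pre[OF sub(3)] S(5,6) by auto
    moreover have "pre S \<union> pre A \<union> pre B = V"
      using S(1) unfolding pre_def W_def by blast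
    moreover have "pre S \<inter> pre A = {}" "pre S \<inter> pre B = {}" "pre A \<inter> pre B = {}"
      using S(2-4) unfolding pre_def by auto
    ultimately have "\<exists>x\<in>pre A. \<exists>y\<in>pre B. {x, y} \<in> E"
      using S(7) by (intro k_connected_cutD[OF G conn, of "pre S"]) auto
    then show "\<exists>x\<in>A. \<exists>y\<in>B. {x, y} \<in> F" using edge unfolding pre_def by blast
  qed
  then have "rigid_graph d W F" by (rule rigid_nat[OF sg])
  moreover have "generic d W P"
  proof -
    have "inj_on (map_prod g id) (W \<times> {..<d})"
      unfolding W_def by (rule inj_onI) (auto simp: gh)
    moreover have "map_prod g id ` (W \<times> {..<d}) \<subseteq> V \<times> {..<d}"
      unfolding W_def using gh by auto
    ultimately have "alg_indep_rat (W \<times> {..<d}) (\<lambda>j. case_prod p (map_prod g id j))"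
      by (rule alg_indep_rat_reindex[OF gen[unfolded generic_def]])
    then show ?thesis unfolding generic_def P_def by (simp add: case_prod_beta' map_prod_def)
  qed
  ultimately have "rigid_framework d W F P" unfolding rigid_graph_def by blast
  then obtain \<epsilon> where "\<epsilon> > 0" and eps: "\<And>Q. \<lbrakk>equivalent_frameworks d F P Q; \<forall>v\<in>W. dist_d d (P v) (Q v) < \<epsilon>\<rbrakk>
      \<Longrightarrow> congruent_frameworks d W P Q"
    unfolding rigid_framework_def by blast
  show ?thesis
    unfolding rigid_framework_def
  proof (intro exI conjI allI impI)
    fix q assume q: "equivalent_frameworks d E p q \<and> (\<forall>v\<in>V. dist_d d (p v) (q v) < \<epsilon>)"
    define Q where "Q n = q (g n)" for n
    have "equivalent_frameworks d F P Q"
      unfolding equivalent_frameworks_def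
    proof (intro allI impI)
      fix m n assume mn: "{m, n} \<in> F"
      then have "m \<in> W" "n \<in> W" using simple_graph_edge[OF sg] by blast+
      then obtain x y where xy: "m = h x" "n = h y" "x \<in> V" "y \<in> V" unfolding W_def by blast
      then have "{x, y} \<in> E" using mn edge by blast
      then show "dist_d d (Q m) (Q n) = dist_d d (P m) (P n)"
        using q xy unfolding equivalent_frameworks_def Q_def P_def by (simp add: gh)
    qed
    moreover have "\<forall>v\<in>W. dist_d d (P v) (Q v) < \<epsilon>"
      using q unfolding W_def P_def Q_def by (simp add: gh)
    ultimately have "congruent_frameworks d W P Q" by (rule eps)
    then show "congruent_frameworks d V p q"
      unfolding congruent_frameworks_def W_def P_def Q_def by (simp add: gh)
  qed fact
qed

text \<open>Induction on the number of vertices with \<open>p\<close> fixed. Elimination keeps the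
  connectivity, so it can be repeated down to \<open>d * (d + 1) + 2\<close> vertices, where the
  graph is complete.\<close>

lemma k_connected_globally_rigid_framework:
  fixes V :: "'a set"
  assumes rigid: "\<And>W F (p :: 'a \<Rightarrow> nat \<Rightarrow> real). simple_graph W F \<Longrightarrow> k_connected (d * (d + 1)) W F \<Longrightarrow>
      generic d W p \<Longrightarrow> rigid_framework d W F p"
    and "0 < d" and "simple_graph V E" and "k_connected (d * (d + 1) + 1) V E" and "generic d V p"
  shows "globally_rigid_framework d V E p"
  using assms(3-)
proof (induction "card V" arbitrary: V E)
  case 0
  then show ?case unfolding k_connected_def by simp
next
  case (Suc n)
  let ?k = "d * (d + 1) + 1"
  have finV: "finite V" using Suc.prems unfolding simple_graph_def by simp
  show ?case
  proof (cases "card V = ?k + 1")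
    case True
    show ?thesis
      unfolding globally_rigid_framework_def congruent_frameworks_def equivalent_frameworks_def
    proof (intro allI impI ballI)
      fix q x y assume eq: "\<forall>u v. {u, v} \<in> E \<longrightarrow> dist_d d (q u) (q v) = dist_d d (p u) (p v)" and xy: "x \<in> V" "y \<in> V"
      show "dist_d d (q x) (q y) = dist_d d (p x) (p y)"
      proof (cases "x = y")
        case False
        then show ?thesis using eq k_connected_min_card_complete[OF Suc.prems(1,2) True xy] by blast
      qed (simp add: dist_d_eq_iff)
    qed
  next
    case False
    then have card: "?k + 2 \<le> card V" using Suc.prems(2) unfolding k_connected_def by simp
    obtain v where v: "v \<in> V" using Suc.hyps(2) by fastforce
    have sub: "V - {v} \<subseteq> V" by blast
    show ?thesis
    proof (rule globally_rigid_framework_eliminate[OF Suc.prems(1) v Suc.prems(3)])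
      show "rigid_framework d (V - {v}) {e \<in> E. v \<notin> e} p"
        by (rule rigid[OF simple_graph_delete[OF Suc.prems(1)] k_connected_delete[OF Suc.prems(1,2) v]
              generic_mono[OF Suc.prems(3) sub]])
      show "globally_rigid_framework d (V - {v}) (eliminate v E) p"
        by (rule Suc.hyps(1)[OF _ simple_graph_eliminate[OF Suc.prems(1)]
              k_connected_eliminate[OF Suc.prems(1,2) v card] generic_mono[OF Suc.prems(3) sub]])
          (use Suc.hyps(2) v finV in simp)
      have "d \<le> d * (d + 1)" by simp
      then show "d + 1 \<le> card (nbrs E v)" using k_connected_card_nbrs[OF Suc.prems(1,2) v] by linarith
    qed fact
  qed
qed

theorem theorem5p8:
  fixes V :: "'a set" and E :: "'a set set"
  assumes conn_rigid: "\<forall>d::nat. 1 \<le> d \<longrightarrow>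
      (\<forall>(W :: nat set) (F :: nat set set).
         simple_graph W F \<and> k_connected (d * (d + 1)) W F \<longrightarrow> rigid_graph d W F)"
    and graph: "simple_graph V E"
  shows "int (grn V E) \<ge> \<lfloor>sqrt (real (card E) / (6 * real (card V)))\<rfloor>"
proof -
  define r where "r = sqrt (real (card E) / (6 * real (card V)))"
  define d where "d = nat \<lfloor>r\<rfloor>"
  have fin: "finite V" using graph unfolding simple_graph_def by simp
  have "r \<ge> 0" unfolding r_def by simp
  then have d: "int d = \<lfloor>r\<rfloor>" unfolding d_def by simp
  have "d \<le> grn V E"
  proof (cases "d = 0")
    case False
    \<comment> \<open>For empty \<open>V\<close> division by zero gives \<open>r = 0\<close> and so
      \<open>d = 0\<close>.\<close>
    then have "V \<noteq> {}" using d unfolding r_def by auto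
    then have pos: "0 < card V" using fin by (simp add: card_gt_0_iff)
    have "real d \<le> r" using d by linarith
    then have "(real d)\<^sup>2 \<le> r\<^sup>2" by (intro power_mono) auto
    also have "r\<^sup>2 = real (card E) / (6 * real (card V))" unfolding r_def by simp
    finally have "(real d)\<^sup>2 * (6 * real (card V)) \<le> real (card E)" using pos by (simp add: field_simps)
    then have "real (2 * (3 * d * d) * card V) \<le> real (card E)" by (simp add: power2_eq_square mult_ac)
    then have edges: "2 * (3 * d * d) * card V \<le> card E" by (simp only: of_nat_le_iff)
    have "1 \<le> d * d" using False by simp
    then obtain U where U: "U \<subseteq> V" "k_connected (3 * d * d) U {e \<in> E. e \<subseteq> U}"
      using mader[OF graph _ \<open>V \<noteq> {}\<close> edges] by auto
    have "d \<le> d * d" by simp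
    then have le: "d * (d + 1) + 1 \<le> 3 * d * d"
      unfolding distrib_left using \<open>1 \<le> d * d\<close> by linarith
    have conn: "k_connected (d * (d + 1) + 1) U {e \<in> E. e \<subseteq> U}" by (rule k_connected_mono[OF U(2) le])
    have sg: "simple_graph U {e \<in> E. e \<subseteq> U}" by (rule simple_graph_subset[OF graph U(1)]) auto
    have "globally_rigid_graph d U {e \<in> E. e \<subseteq> U}"
      unfolding globally_rigid_graph_def
    proof (intro allI impI)
      fix p :: "'a \<Rightarrow> nat \<Rightarrow> real" assume "generic d U p"
      with sg conn show "globally_rigid_framework d U {e \<in> E. e \<subseteq> U} p"
        by (intro k_connected_globally_rigid_framework rigid_framework_transport[of "d * (d + 1)" d])
          (use conn_rigid False in auto)
    qed
    \<comment> \<open>By definition this connectivity comes with at least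
      \<open>d * (d + 1) + 2\<close> vertices.\<close>
    moreover have "d + 2 \<le> card U" using conn \<open>d \<le> d * d\<close> unfolding k_connected_def by simp
    moreover have "subgraph U {e \<in> E. e \<subseteq> U} V E" unfolding subgraph_def using sg U(1) by blast
    ultimately have dims: "d \<in> grn_dims V E" unfolding grn_dims_def using False by auto
    then show ?thesis unfolding grn_def using Max_ge[OF finite_grn_dims[OF fin] dims] by auto
  qed simp
  then show ?thesis using d unfolding r_def by linarith
qed

end
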